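(* Let $n\ge1$ and $k\ge0$ be integers. Every quaternionic linearly convex domain $D\subset\mathbb H^n$ is a domain of $k$-regularity.
   Context: Points of $\mathbb H^n$ are column vectors $\mathbf q=(\mathbf q_1,\dots,\mathbf q_n)^t$, $\mathbf q_{l+1}=x_{4l}+\mathbf i x_{4l+1}+\mathbf j x_{4l+2}+\mathbf k x_{4l+3}$. For $l=0,\dots,n-1$ put $$\nabla^{0'}_{2l}=\tfrac12(\partial_{x_{4l}}-\mathbf i\partial_{x_{4l+1}}),\ \nabla^{0'}_{2l+1}=\tfrac12(\partial_{x_{4l+2}}+\mathbf i\partial_{x_{4l+3}}),\ \nabla^{1'}_{2l}=\tfrac12(-\partial_{x_{4l+2}}+\mathbf i\partial_{x_{4l+3}}),\ \nabla^{1'}_{2l+1}=\tfrac12(\partial_{x_{4l}}+\mathbf i\partial_{x_{4l+1}}).$$ Let $\omega^0,\dots,\omega^{2n-1}$ be anticommuting (Grassmannian) variables, and let $d^{A'}(f_{\mathbf A}\omega^{\mathbf A})=\sum_A\nabla^{A'}_Af_{\mathbf A}\,\omega^A\omega^{\mathbf A}$ for $A'=0',1'$. A smooth $\odot^k\mathbb C^2$-valued function $f$ on an open set is identified with a function that is a homogeneous polynomial of degree $k$ in commuting variables $s_{0'},s_{1'}$ with smooth complex coefficients. The $k$-Cauchy-Fueter operator is $\mathcal D_0=\tfrac12(\partial^{0'}d^{1'}-\partial^{1'}d^{0'})$ with $\partial^{A'}=\partial/\partial s_{A'}$ if $k\ge1$, and $\mathcal D_0=d^{0'}d^{1'}$ if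 $k=0$. The function $f$ is $k$-regular on $D$ if $\mathcal D_0f=0$ on $D$; $\mathcal O_k(D)$ is the space of $k$-regular functions on $D$. A domain $D\subset\mathbb H^n$ is (quaternionic) linearly convex if for every $\mathbf p\in\partial D$ there is a hyperplane of quaternionic dimension $n-1$, i.e. a set $\{\mathbf q\in\mathbb H^n:\mathbf a+\mathbf b\mathbf q=0\}$ with $\mathbf a\in\mathbb H$ and $\mathbf b$ a nonzero quaternionic row vector of length $n$, passing through $\mathbf p$ and not intersecting $D$. A domain $D$ is a domain of $k$-regularity if there do not exist two nonempty open sets $D_1,D_2$ such that (1) $D_1$ is connected, $D_1\not\subseteq D$ and $D_2\subset D_1\cap D$; (2) for each $f\in\mathcal O_k(D)$ there is $\widetilde f\in\mathcal O_k(D_1)$ with $f=\widetilde f$ on $D_2$. *)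

theory Defs
  imports "HOL-Analysis.Analysis"
begin

text \<open>
  The quaternions are \<open>real ^ 4\<close> with the Hamilton product; \<open>x $ 1, x $ 2, x $ 3, x $ 4\<close> are the
  coefficients of \<open>1, i, j, k\<close>. (The library's \<open>*\<close> on \<open>real ^ 4\<close> is componentwise and is not used.)
  Points of the quaternionic n-space are \<open>q :: real ^ 4 ^ 'n\<close> with \<open>n = CARD('n)\<close>. Indexing
  \<open>'n\<close> by \<open>l = 0, ..., n - 1\<close>, the real coordinate \<open>x\<^bsub>4l+m\<^esub>\<close> is \<open>q $ l $ (m + 1)\<close>.
\<close>

type_synonym quat = "real ^ 4"

definition hmult :: "quat \<Rightarrow> quat \<Rightarrow> quat" where
  "hmult p q = vector
    [p $ 1 * q $ 1 - p $ 2 * q $ 2 - p $ 3 * q $ 3 - p $ 4 * q $ 4,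
     p $ 1 * q $ 2 + p $ 2 * q $ 1 + p $ 3 * q $ 4 - p $ 4 * q $ 3,
     p $ 1 * q $ 3 - p $ 2 * q $ 4 + p $ 3 * q $ 1 + p $ 4 * q $ 2,
     p $ 1 * q $ 4 + p $ 2 * q $ 3 - p $ 3 * q $ 2 + p $ 4 * q $ 1]"

definition quat_hyperplane :: "quat \<Rightarrow> quat ^ 'n \<Rightarrow> (quat ^ 'n) set" where
  "quat_hyperplane a b = {q. a + (\<Sum>l\<in>UNIV. hmult (b $ l) (q $ l)) = 0}"

definition is_domain :: "(quat ^ 'n) set \<Rightarrow> bool" where
  "is_domain D \<longleftrightarrow> open D \<and> connected D \<and> D \<noteq> {}"

definition linearly_convex :: "(quat ^ 'n) set \<Rightarrow> bool" where
  "linearly_convex D \<longleftrightarrow>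
    (\<forall>p\<in>frontier D. \<exists>a b. b \<noteq> 0 \<and> p \<in> quat_hyperplane a b \<and> quat_hyperplane a b \<inter> D = {})"

text \<open>Functions of class \<open>C\<^sup>m\<close> and smooth functions; only meant for open sets \<open>S\<close>.\<close>

primrec Ck_on ::
  "nat \<Rightarrow> ('a::real_normed_vector \<Rightarrow> 'b::real_normed_vector) \<Rightarrow> 'a set \<Rightarrow> bool" where
  "Ck_on 0 f S \<longleftrightarrow> continuous_on S f"
| "Ck_on (Suc m) f S \<longleftrightarrow> (\<forall>x\<in>S. f differentiable (at x)) \<and>
     (\<forall>v. Ck_on m (\<lambda>x. frechet_derivative f (at x) v) S)"

definition smooth_on ::
  "('a::real_normed_vector \<Rightarrow> 'b::real_normed_vector) \<Rightarrow> 'a set \<Rightarrow> bool" where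
  "smooth_on f S \<longleftrightarrow> (\<forall>m. Ck_on m f S)"

definition pderiv_at :: "'n \<Rightarrow> 4 \<Rightarrow> (quat ^ 'n \<Rightarrow> complex) \<Rightarrow> quat ^ 'n \<Rightarrow> complex" where
  "pderiv_at l m f q = frechet_derivative f (at q) (axis l (axis m 1))"

text \<open>
  \<open>False\<close> and \<open>True\<close> encode 0 and 1: the pair \<open>(l, b)\<close> is the index \<open>A = 2l + b\<close>, and a Boolean
  \<open>A'\<close> is the primed index \<open>0'\<close> or \<open>1'\<close>. The complex unit of the values is the quaternion unit i.
\<close>

fun nabla ::
  "bool \<Rightarrow> 'n \<times> bool \<Rightarrow> (quat ^ 'n \<Rightarrow> complex) \<Rightarrow> quat ^ 'n \<Rightarrow> complex" where
  "nabla False (l, False) f q = (pderiv_at l 1 f q - \<i> * pderiv_at l 2 f q) / 2"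
| "nabla False (l, True) f q = (pderiv_at l 3 f q + \<i> * pderiv_at l 4 f q) / 2"
| "nabla True (l, False) f q = (- pderiv_at l 3 f q + \<i> * pderiv_at l 4 f q) / 2"
| "nabla True (l, True) f q = (pderiv_at l 1 f q + \<i> * pderiv_at l 2 f q) / 2"

text \<open>
  An element of \<open>\<complex>[s\<^sub>0\<^sub>', s\<^sub>1\<^sub>'] \<otimes> \<Lambda>\<complex>\<^sup>2\<^sup>n\<close> is given by its coefficients: \<open>P a b S\<close> is the coefficient of
  \<open>s\<^sub>0\<^sub>'\<^sup>a s\<^sub>1\<^sub>'\<^sup>b \<omega>\<^sup>S\<close>, where \<open>\<omega>\<^sup>S\<close> is the product of the \<open>\<omega>\<^sup>A\<close>, \<open>A \<in> S\<close>, taken in increasing order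
  of \<open>gen_idx A\<close>. The numbering \<open>to_nat\<close> of \<open>'n\<close> behind this order is arbitrary (and may have gaps);
  changing it only changes the signs of the basis elements \<open>\<omega>\<^sup>S\<close>.
\<close>

type_synonym 'n spinor_form = "nat \<Rightarrow> nat \<Rightarrow> ('n \<times> bool) set \<Rightarrow> complex"

definition gen_idx :: "'n::finite \<times> bool \<Rightarrow> nat" where
  "gen_idx A = 2 * to_nat (fst A) + of_bool (snd A)"

text \<open>
  \<open>d\<^sup>A\<^sup>' F = \<Sum>\<^sub>A \<omega>\<^sup>A \<nabla>\<^sub>A\<^sup>A\<^sup>' F\<close>: moving \<open>\<omega>\<^sup>A\<close> into its place in \<open>\<omega>\<^sup>A \<omega>\<^bsup>S - {A}\<^esup>\<close> yields one sign for
  each smaller generator in \<open>S\<close>, and \<open>\<omega>\<^sup>A \<omega>\<^sup>T = 0\<close> if \<open>A \<in> T\<close>.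
\<close>

definition d_op ::
  "bool \<Rightarrow> (quat ^ 'n \<Rightarrow> 'n spinor_form) \<Rightarrow> quat ^ 'n::finite \<Rightarrow> 'n spinor_form" where
  "d_op A' F q a b S =
    (\<Sum>A\<in>S. (-1) ^ card {B \<in> S. gen_idx B < gen_idx A} * nabla A' A (\<lambda>y. F y a b (S - {A})) q)"

text \<open>The derivation \<open>\<partial>/\<partial>s\<^sub>A\<^sub>'\<close>.\<close>

fun ds_op :: "bool \<Rightarrow> (quat ^ 'n \<Rightarrow> 'n spinor_form) \<Rightarrow> quat ^ 'n \<Rightarrow> 'n spinor_form" where
  "ds_op False F q a b S = of_nat (Suc a) * F q (Suc a) b S"
| "ds_op True F q a b S = of_nat (Suc b) * F q a (Suc b) S"

definition cauchy_fueter ::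
  "nat \<Rightarrow> (quat ^ 'n \<Rightarrow> 'n spinor_form) \<Rightarrow> quat ^ 'n::finite \<Rightarrow> 'n spinor_form" where
  "cauchy_fueter k F =
    (if k = 0 then d_op False (d_op True F)
     else (\<lambda>q a b S. (ds_op False (d_op True F) q a b S - ds_op True (d_op False F) q a b S) / 2))"

definition form_of_poly :: "(nat \<Rightarrow> nat \<Rightarrow> complex) \<Rightarrow> 'n spinor_form" where
  "form_of_poly P a b S = (if S = {} then P a b else 0)"

text \<open>
  The space \<open>O\<^sub>k(D)\<close> for open \<open>D\<close>. A \<open>\<odot>\<^sup>k\<complex>\<^sup>2\<close>-valued function is a function \<open>f\<close> whose values are
  homogeneous polynomials of degree \<open>k\<close>, \<open>f q a b\<close> being the coefficient of \<open>s\<^sub>0\<^sub>'\<^sup>a s\<^sub>1\<^sub>'\<^sup>b\<close>. Values of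
  \<open>f\<close> outside \<open>D\<close> are irrelevant.
\<close>

definition k_regular_fns ::
  "nat \<Rightarrow> (quat ^ 'n::finite) set \<Rightarrow> (quat ^ 'n \<Rightarrow> nat \<Rightarrow> nat \<Rightarrow> complex) set" where
  "k_regular_fns k D = {f.
     (\<forall>q\<in>D. \<forall>a b. a + b \<noteq> k \<longrightarrow> f q a b = 0) \<and>
     (\<forall>a b. smooth_on (\<lambda>q. f q a b) D) \<and>
     (\<forall>q\<in>D. \<forall>a b S. cauchy_fueter k (\<lambda>y. form_of_poly (f y)) q a b S = 0)}"

definition domain_of_k_regularity :: "nat \<Rightarrow> (quat ^ 'n::finite) set \<Rightarrow> bool" where
  "domain_of_k_regularity k D \<longleftrightarrow> is_domain D \<and>
    \<not> (\<exists>D1 D2. open D1 \<and> open D2 \<and> D1 \<noteq> {} \<and> D2 \<noteq> {} \<and>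
         connected D1 \<and> \<not> D1 \<subseteq> D \<and> D2 \<subseteq> D1 \<inter> D \<and>
         (\<forall>f\<in>k_regular_fns k D. \<exists>g\<in>k_regular_fns k D1. \<forall>q\<in>D2. f q = g q))"

end

theory Submission
  imports Defs
begin

text \<open>
  Suppose that \<open>D1\<close> and \<open>D2\<close> contradict the claim, and let \<open>W\<close> be a connected component of \<open>D1 \<inter> D\<close>
  that meets \<open>D2\<close>. Since \<open>D1\<close> is connected and not contained in \<open>D\<close>, the closure of \<open>W\<close> contains a
  point \<open>p\<close> of \<open>D1\<close> outside \<open>D\<close> (\<open>component_boundary_point\<close>). It lies on the boundary of \<open>D\<close>, so linear
  convexity provides a hyperplane \<open>a + b q = 0\<close> through \<open>p\<close> that misses \<open>D\<close>. If a function that is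
  regular on \<open>D\<close> and blows up along this hyperplane had the values of some \<open>g\<close>, regular on \<open>D1\<close>, on the
  set \<open>D2\<close>, then the two would agree on \<open>W\<close> by an identity theorem, although \<open>g\<close> is continuous at \<open>p\<close>.

  The singular function is explicit. With \<open>\<xi> = a + b q\<close>, \<open>\<alpha> = \<xi>\<^sub>1 - i \<xi>\<^sub>2\<close> and \<open>\<beta> = - \<xi>\<^sub>3 + i \<xi>\<^sub>4\<close> it is
  \<open>(s\<^sub>0\<^sub>' \<alpha> + s\<^sub>1\<^sub>' \<beta>)\<^sup>k / |\<xi>|\<^bsup>2k+2\<^esup>\<close>. It is regular off the hyperplane
  (\<open>singular_solution_k_regular\<close>) because \<open>\<nabla>\<^sup>0\<^sup>' \<alpha> = 0\<close>, \<open>\<nabla>\<^sup>1\<^sup>' \<beta> = 0\<close> and \<open>\<nabla>\<^sup>1\<^sup>' \<alpha> = - \<nabla>\<^sup>0\<^sup>' \<beta>\<close>, with similar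
  relations for the conjugates of \<open>\<alpha>\<close> and \<open>\<beta>\<close>; and it blows up
  along the hyperplane because \<open>|\<alpha>|\<^sup>2 + |\<beta>|\<^sup>2 = |\<xi>|\<^sup>2\<close> (\<open>singular_solution_lower_bound\<close>).

  The identity theorem (\<open>k_regular_identity\<close>) holds because the coefficients of a regular function are
  harmonic (\<open>k_regular_harmonic\<close>): eliminating between neighbouring coefficients leaves
  \<open>\<nabla>\<^sup>0\<^sup>'\<^bsub>2l\<^esub> \<nabla>\<^sup>1\<^sup>'\<^bsub>2l+1\<^esub> - \<nabla>\<^sup>0\<^sup>'\<^bsub>2l+1\<^esub> \<nabla>\<^sup>1\<^sup>'\<^bsub>2l\<^esub>\<close>, a quarter of the Laplacian in one quaternionic variable. For
  harmonic functions, unique continuation (\<open>harmonic_identity\<close>) is derived from the maximum principle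
  alone: Bernstein's trick bounds a directional derivative at the centre of a ball of radius \<open>r\<close> by
  \<open>C / r\<close> times the supremum of the function, iteration bounds the derivatives of order \<open>m\<close> by
  \<open>(c m / r)\<^sup>m\<close> times the supremum, and so Taylor expansions along line segments converge to the function.
\<close>

section \<open>Directional derivatives and smooth functions\<close>

definition dir_deriv :: "'a::real_normed_vector \<Rightarrow> ('a \<Rightarrow> 'b::real_normed_vector) \<Rightarrow> 'a \<Rightarrow> 'b" where
  "dir_deriv v f x = frechet_derivative f (at x) v"

lemma dir_deriv_eqI: "(f has_derivative f') (at x) \<Longrightarrow> dir_deriv v f x = f' v"
  by (simp add: dir_deriv_def frechet_derivative_at[symmetric])

lemma differentiable_has_dir_deriv:
  "f differentiable (at x) \<Longrightarrow> (f has_derivative (\<lambda>v. dir_deriv v f x)) (at x)"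
  unfolding dir_deriv_def by (simp add: frechet_derivative_works[symmetric])

lemma dir_deriv_cong:
  assumes "open S" "x \<in> S" "\<And>y. y \<in> S \<Longrightarrow> f y = g y"
  shows "dir_deriv v f x = dir_deriv v g x"
proof -
  have "(f has_derivative F) (at x) \<longleftrightarrow> (g has_derivative F) (at x)" for F
    using assms by (metis has_derivative_transform_within_open)
  then show ?thesis by (simp add: dir_deriv_def frechet_derivative_def)
qed

lemma differentiable_cong:
  assumes "open S" "x \<in> S" "\<And>y. y \<in> S \<Longrightarrow> f y = g y" "f differentiable (at x)"
  shows "g differentiable (at x)"
  using assms unfolding differentiable_def by (metis has_derivative_transform_within_open)

lemma Ck_on_cong:
  assumes "open S"
  shows "(\<And>y. y \<in> S \<Longrightarrow> f y = g y) \<Longrightarrow> Ck_on m f S \<Longrightarrow> Ck_on m g S"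
proof (induction m arbitrary: f g)
  case 0
  then show ?case by (metis Ck_on.simps(1) continuous_on_cong)
next
  case (Suc m)
  have "Ck_on m (\<lambda>x. frechet_derivative g (at x) v) S" for v
    using Suc.IH[of "\<lambda>x. frechet_derivative f (at x) v" "\<lambda>x. frechet_derivative g (at x) v"]
      Suc.prems dir_deriv_cong[OF assms, of _ f g v] by (simp add: dir_deriv_def)
  then show ?case
    using Suc.prems differentiable_cong[OF assms, of _ f g] by auto
qed

text \<open>
  Smoothness is defined by recursion on the order, so closure properties are proved most easily by
  exhibiting a family of functions that is closed under directional derivatives on \<open>S\<close>. The
  derivative is allowed to agree with a member of the family only on the open set \<open>S\<close>, because
  formulas such as the quotient rule hold only there.
\<close>

lemma smooth_on_coinduct:
  assumes "open S" "P f"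
    and step: "\<And>f. P f \<Longrightarrow> (\<forall>x\<in>S. f differentiable (at x)) \<and>
                  (\<forall>v. \<exists>g. P g \<and> (\<forall>x\<in>S. dir_deriv v f x = g x))"
  shows "smooth_on f S"
  unfolding smooth_on_def
proof
  fix m
  show "Ck_on m f S" using \<open>P f\<close>
  proof (induction m arbitrary: f)
    case 0
    then show ?case
      using step by (auto intro!: continuous_at_imp_continuous_on differentiable_imp_continuous_within)
  next
    case (Suc m)
    have "Ck_on m (\<lambda>x. frechet_derivative f (at x) v) S" for v
    proof -
      obtain g where "P g" "\<forall>x\<in>S. dir_deriv v f x = g x" using step[OF Suc.prems] by blast
      then show ?thesis
        using Ck_on_cong[OF \<open>open S\<close>, of g "\<lambda>x. dir_deriv v f x" m] Suc.IH[of g]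
        by (simp add: dir_deriv_def)
    qed
    then show ?case using step[OF Suc.prems] by simp
  qed
qed

lemma smooth_on_differentiable: "smooth_on f S \<Longrightarrow> x \<in> S \<Longrightarrow> f differentiable (at x)"
  unfolding smooth_on_def by (metis Ck_on.simps(2))

lemma smooth_on_dir_deriv: "smooth_on f S \<Longrightarrow> smooth_on (dir_deriv v f) S"
  unfolding smooth_on_def dir_deriv_def [abs_def] by (metis Ck_on.simps(2))

lemma smooth_on_continuous: "smooth_on f S \<Longrightarrow> continuous_on S f"
  unfolding smooth_on_def by (metis Ck_on.simps(1))

lemma smooth_on_subset:
  assumes "smooth_on f S" "T \<subseteq> S" "open T" shows "smooth_on f T"
proof (rule smooth_on_coinduct[where P = "\<lambda>f. smooth_on f S"])
  fix f :: "'a \<Rightarrow> 'b" assume f: "smooth_on f S"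
  show "(\<forall>x\<in>T. f differentiable (at x)) \<and> (\<forall>v. \<exists>g. smooth_on g S \<and> (\<forall>x\<in>T. dir_deriv v f x = g x))"
    using smooth_on_differentiable[OF f] smooth_on_dir_deriv[OF f] assms(2) by blast
qed (use assms in auto)

lemma dir_deriv_const [simp]: "dir_deriv v (\<lambda>_. c) x = 0"
  by (simp add: dir_deriv_def)

lemma dir_deriv_linear_compose:
  assumes "bounded_linear L" "f differentiable (at x)"
  shows "dir_deriv v (\<lambda>x. L (f x)) x = L (dir_deriv v f x)"
  by (intro dir_deriv_eqI bounded_linear.has_derivative[OF assms(1)] differentiable_has_dir_deriv assms)

lemma smooth_on_linear_compose:
  assumes L: "bounded_linear L" and "smooth_on f S" "open S"
  shows "smooth_on (\<lambda>x. L (f x)) S"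
proof (rule smooth_on_coinduct[where P = "\<lambda>h. \<exists>f. smooth_on f S \<and> h = (\<lambda>x. L (f x))"])
  fix h assume "\<exists>f. smooth_on f S \<and> h = (\<lambda>x. L (f x))"
  then obtain f where f: "smooth_on f S" and h: "h = (\<lambda>x. L (f x))" by blast
  have "dir_deriv v h x = L (dir_deriv v f x)" if "x \<in> S" for x v
    unfolding h using L smooth_on_differentiable[OF f that] by (rule dir_deriv_linear_compose)
  moreover have "h differentiable (at x)" if "x \<in> S" for x
    unfolding h using smooth_on_differentiable[OF f that] bounded_linear.has_derivative[OF L]
    by (auto simp: differentiable_def)
  ultimately show "(\<forall>x\<in>S. h differentiable (at x)) \<and> (\<forall>v. \<exists>k. (\<exists>f. smooth_on f S \<and> k = (\<lambda>x. L (f x))) \<and> (\<forall>x\<in>S. dir_deriv v h x = k x))"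
    using smooth_on_dir_deriv[OF f] by (metis (no_types))
qed (use assms in auto)

lemma dir_deriv2_linear_compose:
  assumes "bounded_linear L" "smooth_on f S" "open S" "x \<in> S"
  shows "dir_deriv v (dir_deriv w (\<lambda>x. L (f x))) x = L (dir_deriv v (dir_deriv w f) x)"
proof -
  have "dir_deriv v (dir_deriv w (\<lambda>x. L (f x))) x = dir_deriv v (\<lambda>x. L (dir_deriv w f x)) x"
    by (intro dir_deriv_cong[OF assms(3,4)] dir_deriv_linear_compose[OF assms(1)] smooth_on_differentiable[OF assms(2)])
  also have "\<dots> = L (dir_deriv v (dir_deriv w f) x)"
    by (rule dir_deriv_linear_compose[OF assms(1) smooth_on_differentiable[OF smooth_on_dir_deriv[OF assms(2)] assms(4)]])
  finally show ?thesis .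
qed

lemma smooth_on_affine:
  assumes "bounded_linear L" "open S" shows "smooth_on (\<lambda>x. c + L x) S"
proof (rule smooth_on_coinduct[where P = "\<lambda>h. \<exists>c L. bounded_linear L \<and> h = (\<lambda>x. c + L x)"])
  fix h :: "'a \<Rightarrow> 'b"
  assume "\<exists>c L. bounded_linear L \<and> h = (\<lambda>x. c + L x)"
  then obtain c L where L: "bounded_linear L" and h: "h = (\<lambda>x. c + L x)" by blast
  have d: "(h has_derivative L) (at x)" for x
    unfolding h using bounded_linear.has_derivative[OF L has_derivative_ident]
    by (auto intro!: derivative_eq_intros)
  have "\<exists>g. (\<exists>c L. bounded_linear L \<and> g = (\<lambda>x. c + L x)) \<and> (\<forall>x\<in>S. dir_deriv v h x = g x)" for v
    using dir_deriv_eqI[OF d, of v] bounded_linear_zero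
    by (intro exI[of _ "\<lambda>x. L v + 0"] conjI exI[of _ "L v"] exI[of _ "\<lambda>x. 0"]) simp_all
  then show "(\<forall>x\<in>S. h differentiable (at x)) \<and>
      (\<forall>v. \<exists>g. (\<exists>c L. bounded_linear L \<and> g = (\<lambda>x. c + L x)) \<and> (\<forall>x\<in>S. dir_deriv v h x = g x))"
    using d by (auto simp: differentiable_def)
qed (use assms in auto)

lemma smooth_on_const: "open S \<Longrightarrow> smooth_on (\<lambda>_. c) S"
  using smooth_on_affine[OF bounded_linear_zero, of S c] by simp

text \<open>
  The algebra generated by the smooth functions and by reciprocals. It is closed under directional
  derivatives by the Leibniz and quotient rules, hence contained in the smooth functions; sums,
  products and reciprocals of smooth functions are covered in one stroke. A direct induction on the
  order of smoothness would need the full Leibniz formula.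
\<close>

inductive smooth_alg :: "'a::real_normed_vector set \<Rightarrow> ('a \<Rightarrow> 'b::real_normed_field) \<Rightarrow> bool" for S where
  smooth: "smooth_on f S \<Longrightarrow> smooth_alg S f"
| add: "smooth_alg S f \<Longrightarrow> smooth_alg S g \<Longrightarrow> smooth_alg S (\<lambda>x. f x + g x)"
| mult: "smooth_alg S f \<Longrightarrow> smooth_alg S g \<Longrightarrow> smooth_alg S (\<lambda>x. f x * g x)"
| inverse: "smooth_alg S f \<Longrightarrow> (\<And>x. x \<in> S \<Longrightarrow> f x \<noteq> 0) \<Longrightarrow> smooth_alg S (\<lambda>x. inverse (f x))"

lemma dir_deriv_add:
  assumes "f differentiable (at x)" "g differentiable (at x)"
  shows "dir_deriv v (\<lambda>x. f x + g x) x = dir_deriv v f x + dir_deriv v g x"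
  by (intro dir_deriv_eqI has_derivative_add differentiable_has_dir_deriv assms)

lemma dir_deriv_mult:
  fixes f g :: "'a::real_normed_vector \<Rightarrow> 'b::real_normed_field"
  assumes "f differentiable (at x)" "g differentiable (at x)"
  shows "dir_deriv v (\<lambda>x. f x * g x) x = f x * dir_deriv v g x + dir_deriv v f x * g x"
  by (intro dir_deriv_eqI has_derivative_mult differentiable_has_dir_deriv assms)

lemma dir_deriv_inverse:
  fixes f :: "'a::real_normed_vector \<Rightarrow> 'b::real_normed_field"
  assumes "f differentiable (at x)" "f x \<noteq> 0"
  shows "dir_deriv v (\<lambda>x. inverse (f x)) x = - (inverse (f x) * dir_deriv v f x * inverse (f x))"
  by (rule dir_deriv_eqI[OF Deriv.has_derivative_inverse[OF assms(2) differentiable_has_dir_deriv[OF assms(1)]]])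

lemma differentiable_inverse_field:
  fixes f :: "'a::real_normed_vector \<Rightarrow> 'b::real_normed_field"
  assumes "f differentiable (at x)" "f x \<noteq> 0"
  shows "(\<lambda>x. inverse (f x)) differentiable (at x)"
  using Deriv.has_derivative_inverse[OF assms(2) differentiable_has_dir_deriv[OF assms(1)]]
  by (auto simp: differentiable_def)

lemma smooth_on_smooth_alg:
  assumes S: "open S" and "smooth_alg S f"
  shows "smooth_on f S"
proof (rule smooth_on_coinduct[where P = "smooth_alg S", OF assms])
  fix f :: "'a \<Rightarrow> 'b" assume "smooth_alg S f"
  then show "(\<forall>x\<in>S. f differentiable (at x)) \<and> (\<forall>v. \<exists>g. smooth_alg S g \<and> (\<forall>x\<in>S. dir_deriv v f x = g x))"
  proof induction
    case (smooth f)
    have "smooth_alg S (dir_deriv v f)" for v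
      by (rule smooth_alg.smooth[OF smooth_on_dir_deriv[OF smooth]])
    then show ?case using smooth_on_differentiable[OF smooth] by blast
  next
    case (add f g)
    have "\<exists>h. smooth_alg S h \<and> (\<forall>x\<in>S. dir_deriv v (\<lambda>x. f x + g x) x = h x)" for v
    proof -
      obtain f' g' where *: "smooth_alg S f'" "smooth_alg S g'"
        "\<forall>x\<in>S. dir_deriv v f x = f' x" "\<forall>x\<in>S. dir_deriv v g x = g' x"
        using add.IH by blast
      then show ?thesis
        using add.IH by (intro exI[of _ "\<lambda>x. f' x + g' x"] conjI smooth_alg.add) (simp_all add: dir_deriv_add)
    qed
    then show ?case using add.IH by (simp add: differentiable_add)
  next
    case (mult f g)
    have "\<exists>h. smooth_alg S h \<and> (\<forall>x\<in>S. dir_deriv v (\<lambda>x. f x * g x) x = h x)" for v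
    proof -
      obtain f' g' where *: "smooth_alg S f'" "smooth_alg S g'"
        "\<forall>x\<in>S. dir_deriv v f x = f' x" "\<forall>x\<in>S. dir_deriv v g x = g' x"
        using mult.IH by blast
      then show ?thesis
        using mult.IH mult.hyps
        by (intro exI[of _ "\<lambda>x. f x * g' x + f' x * g x"] conjI smooth_alg.add smooth_alg.mult)
           (simp_all add: dir_deriv_mult)
    qed
    then show ?case using mult.IH by (simp add: differentiable_mult)
  next
    case (inverse f)
    have "\<exists>h. smooth_alg S h \<and> (\<forall>x\<in>S. dir_deriv v (\<lambda>x. inverse (f x)) x = h x)" for v
    proof -
      obtain f' where *: "smooth_alg S f'" "\<forall>x\<in>S. dir_deriv v f x = f' x"
        using inverse.IH by blast
      then show ?thesis
        using inverse.IH inverse.hyps smooth_alg.smooth[OF smooth_on_const[OF S]]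
        by (intro exI[of _ "\<lambda>x. (-1) * (inverse (f x) * f' x * inverse (f x))"] conjI
              smooth_alg.mult smooth_alg.inverse)
           (simp_all add: dir_deriv_inverse)
    qed
    then show ?case using inverse.IH inverse.hyps by (simp add: differentiable_inverse_field)
  qed
qed

lemma smooth_on_add:
  fixes f g :: "'a::real_normed_vector \<Rightarrow> 'b::real_normed_field"
  assumes "open S" "smooth_on f S" "smooth_on g S"
  shows "smooth_on (\<lambda>x. f x + g x) S"
  by (rule smooth_on_smooth_alg[OF assms(1) smooth_alg.add[OF assms(2,3)[THEN smooth_alg.smooth]]])

lemma smooth_on_mult:
  fixes f g :: "'a::real_normed_vector \<Rightarrow> 'b::real_normed_field"
  assumes "open S" "smooth_on f S" "smooth_on g S"
  shows "smooth_on (\<lambda>x. f x * g x) S"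
  by (rule smooth_on_smooth_alg[OF assms(1) smooth_alg.mult[OF assms(2,3)[THEN smooth_alg.smooth]]])

lemma smooth_on_inverse:
  fixes f :: "'a::real_normed_vector \<Rightarrow> 'b::real_normed_field"
  assumes "open S" "smooth_on f S" "\<And>x. x \<in> S \<Longrightarrow> f x \<noteq> 0"
  shows "smooth_on (\<lambda>x. inverse (f x)) S"
  by (rule smooth_on_smooth_alg[OF assms(1) smooth_alg.inverse[OF smooth_alg.smooth[OF assms(2)] assms(3)]])

lemma smooth_on_power:
  fixes f :: "'a::real_normed_vector \<Rightarrow> 'b::real_normed_field"
  assumes "open S" "smooth_on f S"
  shows "smooth_on (\<lambda>x. f x ^ n) S"
  by (induction n) (simp_all add: smooth_on_const smooth_on_mult assms)

section \<open>Symmetry of second derivatives\<close>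

lemma has_real_derivative_along_line:
  fixes f :: "'a::real_normed_vector \<Rightarrow> real"
  assumes "f differentiable (at (x + t *\<^sub>R v))"
  shows "((\<lambda>s. f (x + s *\<^sub>R v)) has_real_derivative dir_deriv v f (x + t *\<^sub>R v)) (at t)"
proof -
  have "((\<lambda>s. f (x + s *\<^sub>R v)) has_derivative (\<lambda>s. dir_deriv (s *\<^sub>R v) f (x + t *\<^sub>R v))) (at t)"
    by (rule has_derivative_compose[of "\<lambda>s. x + s *\<^sub>R v" _ _ _ f, OF _ differentiable_has_dir_deriv[OF assms]])
       (auto intro!: derivative_eq_intros)
  moreover have "dir_deriv (s *\<^sub>R v) f (x + t *\<^sub>R v) = dir_deriv v f (x + t *\<^sub>R v) * s" for s
    using linear_scale[OF linear_frechet_derivative[OF assms]] by (simp add: dir_deriv_def)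
  ultimately show ?thesis by (simp add: has_field_derivative_def mult_commute_abs)
qed

text \<open>
  Two applications of the mean value theorem to the mixed second difference, first in the direction
  \<open>v\<close> and then in the direction \<open>w\<close>. The left-hand side is symmetric in \<open>v\<close> and \<open>w\<close>.
\<close>

lemma mixed_difference_mvt:
  fixes f :: "'a::real_normed_vector \<Rightarrow> real"
  assumes f: "smooth_on f S" and h: "0 < h"
    and S: "\<And>s t. 0 \<le> s \<Longrightarrow> s \<le> h \<Longrightarrow> 0 \<le> t \<Longrightarrow> t \<le> h \<Longrightarrow> x + s *\<^sub>R v + t *\<^sub>R w \<in> S"
  shows "\<exists>s t. 0 \<le> s \<and> s \<le> h \<and> 0 \<le> t \<and> t \<le> h \<and>
    f (x + h *\<^sub>R v + h *\<^sub>R w) - f (x + h *\<^sub>R v) - f (x + h *\<^sub>R w) + f x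
      = h * h * dir_deriv w (dir_deriv v f) (x + s *\<^sub>R v + t *\<^sub>R w)"
proof -
  have d1: "((\<lambda>s. f (x + s *\<^sub>R v + h *\<^sub>R w) - f (x + s *\<^sub>R v)) has_real_derivative
      dir_deriv v f (x + s *\<^sub>R v + h *\<^sub>R w) - dir_deriv v f (x + s *\<^sub>R v)) (at s)"
    if "0 \<le> s" "s \<le> h" for s
  proof -
    have "((\<lambda>s. f ((x + h *\<^sub>R w) + s *\<^sub>R v)) has_real_derivative
        dir_deriv v f ((x + h *\<^sub>R w) + s *\<^sub>R v)) (at s)"
      using S[of s h] that h smooth_on_differentiable[OF f]
      by (intro has_real_derivative_along_line) (simp add: algebra_simps)
    moreover have "((\<lambda>s. f (x + s *\<^sub>R v)) has_real_derivative dir_deriv v f (x + s *\<^sub>R v)) (at s)"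
      using S[of s 0] that h smooth_on_differentiable[OF f]
      by (intro has_real_derivative_along_line) (simp add: algebra_simps)
    ultimately show ?thesis by (auto intro!: derivative_eq_intros simp: algebra_simps)
  qed
  obtain s where s: "0 < s" "s < h" and
    e1: "(f (x + h *\<^sub>R v + h *\<^sub>R w) - f (x + h *\<^sub>R v)) - (f (x + h *\<^sub>R w) - f x)
       = h * (dir_deriv v f (x + s *\<^sub>R v + h *\<^sub>R w) - dir_deriv v f (x + s *\<^sub>R v))"
    using MVT2[OF h d1] by auto
  have d2: "((\<lambda>t. dir_deriv v f ((x + s *\<^sub>R v) + t *\<^sub>R w)) has_real_derivative
      dir_deriv w (dir_deriv v f) ((x + s *\<^sub>R v) + t *\<^sub>R w)) (at t)" if "0 \<le> t" "t \<le> h" for t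
    using S[of s t] that s smooth_on_differentiable[OF smooth_on_dir_deriv[OF f]]
    by (intro has_real_derivative_along_line) (simp add: algebra_simps)
  obtain t where t: "0 < t" "t < h" and
    e2: "dir_deriv v f (x + s *\<^sub>R v + h *\<^sub>R w) - dir_deriv v f (x + s *\<^sub>R v)
       = h * dir_deriv w (dir_deriv v f) (x + s *\<^sub>R v + t *\<^sub>R w)"
    using MVT2[OF h d2] by auto
  show ?thesis using e1 e2 s t by (intro exI[of _ s] exI[of _ t]) (auto simp: algebra_simps)
qed

text \<open>
  Schwarz's theorem. By the symmetry of the mixed difference, in every neighbourhood of \<open>x\<close> there
  are two points at which the two mixed derivatives take the same value; both are continuous at \<open>x\<close>.
\<close>

lemma dir_deriv_commute_real:
  fixes f :: "'a::real_normed_vector \<Rightarrow> real"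
  assumes f: "smooth_on f S" and S: "open S" "x \<in> S"
  shows "dir_deriv v (dir_deriv w f) x = dir_deriv w (dir_deriv v f) x"
proof -
  \<comment> \<open>the summand 1 makes \<open>n\<close> positive even if \<open>v\<close> and \<open>w\<close> vanish\<close>
  define n where "n = norm v + norm w + 1"
  have n: "n > 0" by (simp add: n_def add_nonneg_pos)
  obtain r where r: "r > 0" "ball x r \<subseteq> S" using S openE by blast
  have small: "dist (x + s *\<^sub>R v + t *\<^sub>R w) x < e"
    if "0 \<le> s" "s \<le> h" "0 \<le> t" "t \<le> h" "h * n < e" "0 < h" for s t h e
  proof -
    have "norm (s *\<^sub>R v + t *\<^sub>R w) \<le> s * norm v + t * norm w"
      using norm_triangle_ineq[of "s *\<^sub>R v" "t *\<^sub>R w"] that by simp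
    also have "\<dots> \<le> h * norm v + h * norm w"
      using that by (intro add_mono mult_right_mono) auto
    also have "\<dots> < e" using that by (simp add: n_def algebra_simps)
    finally show ?thesis by (simp add: dist_norm add.assoc)
  qed
  have "\<bar>dir_deriv v (dir_deriv w f) x - dir_deriv w (dir_deriv v f) x\<bar> < e" if "e > 0" for e
  proof -
    have "isCont (dir_deriv v (dir_deriv w f)) x" "isCont (dir_deriv w (dir_deriv v f)) x"
      using f S by (meson smooth_on_continuous smooth_on_dir_deriv continuous_on_eq_continuous_at)+
    then obtain d1 d2 where d: "d1 > 0" "d2 > 0"
      "\<And>y. dist y x < d1 \<Longrightarrow> \<bar>dir_deriv v (dir_deriv w f) y - dir_deriv v (dir_deriv w f) x\<bar> < e/2"
      "\<And>y. dist y x < d2 \<Longrightarrow> \<bar>dir_deriv w (dir_deriv v f) y - dir_deriv w (dir_deriv v f) x\<bar> < e/2"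
      unfolding continuous_at_eps_delta using \<open>e > 0\<close> by (metis dist_real_def half_gt_zero)
    define m where "m = min r (min d1 d2)"
    have m: "m > 0" using r d by (simp add: m_def)
    define h where "h = m / (2 * n)"
    have h: "h > 0" "h * n < m" using m n by (auto simp: h_def)
    have inS: "x + s *\<^sub>R v + t *\<^sub>R w \<in> S" if "0 \<le> s" "s \<le> h" "0 \<le> t" "t \<le> h" for s t
      using small[OF that h(2,1)] r by (auto simp: m_def dist_commute)
    obtain s t where st: "0 \<le> s" "s \<le> h" "0 \<le> t" "t \<le> h"
      "f (x + h *\<^sub>R v + h *\<^sub>R w) - f (x + h *\<^sub>R v) - f (x + h *\<^sub>R w) + f x
        = h * h * dir_deriv w (dir_deriv v f) (x + s *\<^sub>R v + t *\<^sub>R w)"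
      using mixed_difference_mvt[OF f h(1) inS] by blast
    have inS': "x + s *\<^sub>R w + t *\<^sub>R v \<in> S" if "0 \<le> s" "s \<le> h" "0 \<le> t" "t \<le> h" for s t
      using inS[of t s] that by (simp add: algebra_simps)
    obtain s' t' where st': "0 \<le> s'" "s' \<le> h" "0 \<le> t'" "t' \<le> h"
      "f (x + h *\<^sub>R w + h *\<^sub>R v) - f (x + h *\<^sub>R w) - f (x + h *\<^sub>R v) + f x
        = h * h * dir_deriv v (dir_deriv w f) (x + s' *\<^sub>R w + t' *\<^sub>R v)"
      using mixed_difference_mvt[OF f h(1) inS'] by blast
    have comm: "x + h *\<^sub>R w + h *\<^sub>R v = x + h *\<^sub>R v + h *\<^sub>R w" "x + s' *\<^sub>R w + t' *\<^sub>R v = x + t' *\<^sub>R v + s' *\<^sub>R w"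
      by (simp_all add: algebra_simps)
    have "h * h * dir_deriv w (dir_deriv v f) (x + s *\<^sub>R v + t *\<^sub>R w) = h * h * dir_deriv v (dir_deriv w f) (x + t' *\<^sub>R v + s' *\<^sub>R w)"
      using st(5) st'(5) unfolding comm by linarith
    then have eq: "dir_deriv w (dir_deriv v f) (x + s *\<^sub>R v + t *\<^sub>R w) = dir_deriv v (dir_deriv w f) (x + t' *\<^sub>R v + s' *\<^sub>R w)"
      using h by simp
    have "\<bar>dir_deriv v (dir_deriv w f) (x + t' *\<^sub>R v + s' *\<^sub>R w) - dir_deriv v (dir_deriv w f) x\<bar> < e/2"
      using small[OF st'(3,4,1,2) h(2,1)] by (intro d(3)) (simp add: m_def)
    moreover have "\<bar>dir_deriv w (dir_deriv v f) (x + s *\<^sub>R v + t *\<^sub>R w) - dir_deriv w (dir_deriv v f) x\<bar> < e/2"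
      using small[OF st(1-4) h(2,1)] by (intro d(4)) (simp add: m_def)
    ultimately show ?thesis unfolding eq by linarith
  qed
  from this[of "\<bar>dir_deriv v (dir_deriv w f) x - dir_deriv w (dir_deriv v f) x\<bar>"] show ?thesis by fastforce
qed

lemma dir_deriv_commute:
  fixes f :: "'a::real_normed_vector \<Rightarrow> 'b::euclidean_space"
  assumes f: "smooth_on f S" and S: "open S" "x \<in> S"
  shows "dir_deriv v (dir_deriv w f) x = dir_deriv w (dir_deriv v f) x"
proof (rule euclidean_eqI)
  fix b :: 'b
  have L: "bounded_linear (\<lambda>y. y \<bullet> b)" by (rule bounded_linear_inner_left)
  show "dir_deriv v (dir_deriv w f) x \<bullet> b = dir_deriv w (dir_deriv v f) x \<bullet> b"
    using dir_deriv_commute_real[OF smooth_on_linear_compose[OF L f S(1)] S, of v w]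
    by (simp add: dir_deriv2_linear_compose[OF L f S])
qed

section \<open>Harmonic functions and their identity theorem\<close>

definition laplacian :: "('a::euclidean_space \<Rightarrow> 'b::real_normed_vector) \<Rightarrow> 'a \<Rightarrow> 'b" where
  "laplacian f x = (\<Sum>i\<in>Basis. dir_deriv i (dir_deriv i f) x)"

definition harmonic_on :: "('a::euclidean_space \<Rightarrow> 'b::real_normed_vector) \<Rightarrow> 'a set \<Rightarrow> bool" where
  "harmonic_on f S \<longleftrightarrow> smooth_on f S \<and> (\<forall>x\<in>S. laplacian f x = 0)"

lemma harmonic_on_dir_deriv:
  fixes f :: "'a::euclidean_space \<Rightarrow> 'b::euclidean_space"
  assumes S: "open S" and f: "harmonic_on f S"
  shows "harmonic_on (dir_deriv e f) S"
  unfolding harmonic_on_def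
proof (intro conjI ballI)
  have sm: "smooth_on f S" using f by (simp add: harmonic_on_def)
  then show "smooth_on (dir_deriv e f) S" by (rule smooth_on_dir_deriv)
  fix x assume x: "x \<in> S"
  have "dir_deriv i (dir_deriv i (dir_deriv e f)) x = dir_deriv e (dir_deriv i (dir_deriv i f)) x" for i
  proof -
    have "dir_deriv i (dir_deriv i (dir_deriv e f)) x = dir_deriv i (dir_deriv e (dir_deriv i f)) x"
      by (rule dir_deriv_cong[OF S x dir_deriv_commute[OF sm S]])
    also have "\<dots> = dir_deriv e (dir_deriv i (dir_deriv i f)) x"
      by (rule dir_deriv_commute[OF smooth_on_dir_deriv[OF sm] S x])
    finally show ?thesis .
  qed
  then have "laplacian (dir_deriv e f) x = (\<Sum>i\<in>Basis. dir_deriv e (dir_deriv i (dir_deriv i f)) x)"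
    by (simp add: laplacian_def)
  also have "\<dots> = dir_deriv e (laplacian f) x"
    unfolding laplacian_def [abs_def]
    by (rule sym, intro dir_deriv_eqI has_derivative_sum differentiable_has_dir_deriv
          smooth_on_differentiable[OF smooth_on_dir_deriv[OF smooth_on_dir_deriv[OF sm]] x])
  also have "\<dots> = dir_deriv e (\<lambda>_. 0) x"
    using f by (intro dir_deriv_cong[OF S x]) (simp add: harmonic_on_def)
  finally show "laplacian (dir_deriv e f) x = 0" by simp
qed

lemma harmonic_on_diff:
  fixes f g :: "'a::euclidean_space \<Rightarrow> 'b::real_normed_field"
  assumes S: "open S" and f: "harmonic_on f S" and g: "harmonic_on g S"
  shows "harmonic_on (\<lambda>x. f x - g x) S"
proof -
  have sm: "smooth_on f S" "smooth_on g S" using f g by (auto simp: harmonic_on_def)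
  have d: "dir_deriv v (\<lambda>x. f x - g x) x = dir_deriv v f x - dir_deriv v g x"
    if "smooth_on f S" "smooth_on g S" "x \<in> S" for f g :: "'a \<Rightarrow> 'b" and v x
    by (intro dir_deriv_eqI has_derivative_diff differentiable_has_dir_deriv
          smooth_on_differentiable[OF that(1,3)] smooth_on_differentiable[OF that(2,3)])
  have "dir_deriv v (dir_deriv v (\<lambda>x. f x - g x)) x = dir_deriv v (dir_deriv v f) x - dir_deriv v (dir_deriv v g) x"
    if "x \<in> S" for x v
  proof -
    have "dir_deriv v (dir_deriv v (\<lambda>x. f x - g x)) x = dir_deriv v (\<lambda>x. dir_deriv v f x - dir_deriv v g x) x"
      by (rule dir_deriv_cong[OF S that]) (rule d[OF sm])
    also have "\<dots> = dir_deriv v (dir_deriv v f) x - dir_deriv v (dir_deriv v g) x"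
      by (rule d[OF sm[THEN smooth_on_dir_deriv] that])
    finally show ?thesis .
  qed
  then have "laplacian (\<lambda>x. f x - g x) x = laplacian f x - laplacian g x" if "x \<in> S" for x
    using that by (simp add: laplacian_def sum_subtractf)
  moreover have "smooth_on (\<lambda>x. f x - g x) S"
    using smooth_on_add[OF S sm(1) smooth_on_mult[OF S smooth_on_const[OF S, of "-1"] sm(2)]] by simp
  ultimately show ?thesis using f g by (simp add: harmonic_on_def)
qed

lemma second_derivative_at_max_nonpos:
  fixes \<phi> :: "real \<Rightarrow> real"
  assumes d: "0 < d" and max: "\<And>t. \<bar>t\<bar> < d \<Longrightarrow> \<phi> t \<le> \<phi> 0"
    and der: "\<And>t. \<bar>t\<bar> < d \<Longrightarrow> (\<phi> has_real_derivative \<phi>' t) (at t)"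
    and der2: "(\<phi>' has_real_derivative c) (at 0)"
  shows "c \<le> 0"
proof (rule ccontr)
  assume "\<not> c \<le> 0"
  then obtain d' where d': "d' > 0" "\<And>h. 0 < h \<Longrightarrow> h < d' \<Longrightarrow> \<phi>' 0 < \<phi>' h"
    using DERIV_pos_inc_right[OF der2] by auto
  have "\<phi>' 0 = 0"
    using DERIV_local_max[OF der[of 0] d] max d by simp
  define h where "h = min d d' / 2"
  have h: "0 < h" "h < d" "h < d'" using d d' by (auto simp: h_def)
  have "\<exists>z>0. z < h \<and> \<phi> h - \<phi> 0 = (h - 0) * \<phi>' z"
    using h by (intro MVT2 der) auto
  then obtain z where z: "0 < z" "z < h" "\<phi> h - \<phi> 0 = h * \<phi>' z" by auto
  have "\<phi>' z > 0" using d'(2)[of z] z h \<open>\<phi>' 0 = 0\<close> by simp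
  then have "h * \<phi>' z > 0" using h by simp
  moreover have "\<phi> h \<le> \<phi> 0" using max[of h] h by simp
  ultimately show False using z by linarith
qed

text \<open>
  Cauchy-Schwarz, with the derivative expanded in the orthonormal basis.
\<close>

lemma directional_derivative_le_gradient:
  fixes u :: "'a::euclidean_space \<Rightarrow> real"
  assumes "u differentiable (at x)" "norm e = 1"
  shows "(dir_deriv e u x)\<^sup>2 \<le> (\<Sum>i\<in>Basis. (dir_deriv i u x)\<^sup>2)"
proof -
  have lin: "linear (\<lambda>v. dir_deriv v u x)"
    unfolding dir_deriv_def using linear_frechet_derivative[OF assms(1)] by simp
  have "dir_deriv e u x = dir_deriv (\<Sum>i\<in>Basis. (e \<bullet> i) *\<^sub>R i) u x" by (simp add: euclidean_representation)
  also have "\<dots> = (\<Sum>i\<in>Basis. (e \<bullet> i) * dir_deriv i u x)"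
    using linear_sum[OF lin, of "\<lambda>i. (e \<bullet> i) *\<^sub>R i" Basis] linear_scale[OF lin] by simp
  finally have "(dir_deriv e u x)\<^sup>2 = (\<Sum>i\<in>Basis. (e \<bullet> i) * dir_deriv i u x)\<^sup>2" by simp
  also have "\<dots> \<le> (\<Sum>i\<in>Basis. (e \<bullet> i)\<^sup>2) * (\<Sum>i\<in>Basis. (dir_deriv i u x)\<^sup>2)"
    by (rule Cauchy_Schwarz_ineq_sum)
  also have "(\<Sum>i\<in>Basis. (e \<bullet> i)\<^sup>2) = 1"
    using euclidean_inner[of e e] assms(2) by (simp add: power2_eq_square norm_eq_1)
  finally show ?thesis by simp
qed

text \<open>
  Bernstein's argument: with \<open>v\<close> the derivative of \<open>u\<close> in the direction \<open>e\<close> and \<open>\<eta>\<close> a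
  cut-off vanishing on the sphere, \<open>w = \<eta>\<^sup>2 v\<^sup>2 + A u\<^sup>2\<close> satisfies \<open>\<Delta> w > 0\<close> wherever \<open>v \<noteq> 0\<close>
  inside the ball, provided that \<open>A\<close> is large: the terms \<open>2 \<eta>\<^sup>2 |\<nabla> v|\<^sup>2\<close> and
  \<open>2 A |\<nabla> u|\<^sup>2 \<ge> 2 A v\<^sup>2\<close> absorb everything else. Hence \<open>w\<close> attains its maximum where \<open>\<eta> v = 0\<close>,
  and there \<open>w \<le> A M\<^sup>2\<close>; evaluating \<open>w\<close> at the centre gives the bound.
\<close>

lemma harmonic_gradient_bound:
  fixes u :: "'a::euclidean_space \<Rightarrow> real"
  assumes S: "open S" and u: "harmonic_on u S" and r: "0 < r" "cball x0 r \<subseteq> S"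
    and M: "\<And>x. x \<in> cball x0 r \<Longrightarrow> \<bar>u x\<bar> \<le> M" and e: "norm e = 1"
  shows "\<bar>dir_deriv e u x0\<bar> \<le> sqrt (2 * DIM('a) + 13) / r * M"
proof -
  define N where "N = real DIM('a)"
  \<comment> \<open>any constant above \<open>r\<^sup>2 (2 N + 12)\<close> makes the Laplacian of \<open>w\<close> positive where \<open>v \<noteq> 0\<close>\<close>
  define A where "A = r\<^sup>2 * (2 * N + 13)"
  define v where "v = dir_deriv e u"
  define \<eta> where "\<eta> x = r\<^sup>2 - (x - x0) \<bullet> (x - x0)" for x
  define w where "w x = (\<eta> x)\<^sup>2 * (v x)\<^sup>2 + A * (u x)\<^sup>2" for x
  have N: "N \<ge> 1" unfolding N_def by (simp add: DIM_positive Suc_leI)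
  have A: "A > 0" using r N by (simp add: A_def)
  have M0: "M \<ge> 0" using M[of x0] r by force
  have smu: "smooth_on u S" and smv: "smooth_on v S"
    using u smooth_on_dir_deriv unfolding harmonic_on_def v_def by blast+
  have v: "harmonic_on v S" unfolding v_def by (rule harmonic_on_dir_deriv[OF S u])
  have "continuous_on (cball x0 r) w" unfolding w_def \<eta>_def
    using smooth_on_continuous[OF smu] smooth_on_continuous[OF smv] r
    by (intro continuous_intros) (auto intro: continuous_on_subset)
  then obtain y where y: "y \<in> cball x0 r" and ymax: "\<And>x. x \<in> cball x0 r \<Longrightarrow> w x \<le> w y"
    using continuous_attains_sup[OF compact_cball, of x0 r w] r by auto
  have "w y \<le> A * M\<^sup>2"
  proof (cases "\<eta> y = 0 \<or> v y = 0")
    case True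
    then have "w y = A * \<bar>u y\<bar>\<^sup>2" by (auto simp: w_def)
    also have "\<dots> \<le> A * M\<^sup>2" using M[OF y] A by (intro mult_left_mono power_mono) auto
    finally show ?thesis .
  next
    case False
    define z where "z = y - x0"
    have zr: "z \<bullet> z \<le> r\<^sup>2"
      using y r by (simp add: z_def dist_norm norm_minus_commute power2_norm_eq_inner[symmetric] power_mono)
    have \<eta>y: "\<eta> y = r\<^sup>2 - z \<bullet> z" by (simp add: \<eta>_def z_def)
    have \<eta>pos: "\<eta> y > 0" using False zr \<eta>y by simp
    have "norm z < r"
      using \<eta>pos \<eta>y r by (metis diff_gt_0_iff_gt less_eq_real_def power2_norm_eq_inner power_less_imp_less_base)
    then have yb: "y \<in> ball x0 r" by (simp add: z_def dist_norm norm_minus_commute)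
    have yS: "y \<in> S" using y r by blast
    \<comment> \<open>second derivative test for \<open>w\<close> along the axis \<open>i\<close>, with the mixed term absorbed by a square\<close>
    have key: "(- 24 * (z \<bullet> i)\<^sup>2 - 4 * \<eta> y) * (v y)\<^sup>2 + 2 * (\<eta> y)\<^sup>2 * v y * dir_deriv i (dir_deriv i v) y
        + 2 * A * (dir_deriv i u y)\<^sup>2 + 2 * A * u y * dir_deriv i (dir_deriv i u) y \<le> 0"
      if i: "i \<in> Basis" for i
    proof -
      have ii: "i \<bullet> i = 1" using i by simp
      define h where "h t = \<eta> y - 2 * t * (z \<bullet> i) - t * t" for t
      define \<phi> where "\<phi> t = (h t)\<^sup>2 * (v (y + t *\<^sub>R i))\<^sup>2 + A * (u (y + t *\<^sub>R i))\<^sup>2" for t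
      define h' where "h' t = - 2 * (z \<bullet> i) - 2 * t" for t
      define \<phi>' where "\<phi>' t = 2 * h t * h' t * (v (y + t *\<^sub>R i))\<^sup>2
          + (h t)\<^sup>2 * (2 * v (y + t *\<^sub>R i) * dir_deriv i v (y + t *\<^sub>R i))
          + A * (2 * u (y + t *\<^sub>R i) * dir_deriv i u (y + t *\<^sub>R i))" for t
      define c where "c = 2 * ((h' 0)\<^sup>2 - 2 * h 0) * (v y)\<^sup>2 + 8 * h 0 * h' 0 * v y * dir_deriv i v y
          + 2 * (h 0)\<^sup>2 * ((dir_deriv i v y)\<^sup>2 + v y * dir_deriv i (dir_deriv i v) y)
          + 2 * A * ((dir_deriv i u y)\<^sup>2 + u y * dir_deriv i (dir_deriv i u) y)"
      have \<phi>w: "\<phi> t = w (y + t *\<^sub>R i)" for t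
      proof -
        have "\<eta> (y + t *\<^sub>R i) = r\<^sup>2 - (z + t *\<^sub>R i) \<bullet> (z + t *\<^sub>R i)"
          by (simp add: \<eta>_def z_def algebra_simps)
        also have "\<dots> = h t"
          using ii by (simp add: h_def \<eta>y inner_add_left inner_add_right inner_commute)
        finally show ?thesis by (simp add: \<phi>_def w_def)
      qed
      obtain d where d: "d > 0" "ball y d \<subseteq> ball x0 r" using yb openE[OF open_ball] by blast
      have near: "y + t *\<^sub>R i \<in> ball x0 r" if "\<bar>t\<bar> < d" for t
        using that i by (intro subsetD[OF d(2)]) (simp add: dist_norm)
      have nS: "y + t *\<^sub>R i \<in> S" if "\<bar>t\<bar> < d" for t
        using near[OF that] r ball_subset_cball by blast
      have hd: "(h has_real_derivative h' t) (at t)" for t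
        unfolding h_def h'_def by (auto intro!: derivative_eq_intros)
      have h'd: "(h' has_real_derivative -2) (at t)" for t
        unfolding h'_def by (auto intro!: derivative_eq_intros)
      note line = has_real_derivative_along_line[OF smooth_on_differentiable]
      have "c \<le> 0"
      proof (rule second_derivative_at_max_nonpos[OF d(1)])
        fix t :: real assume t: "\<bar>t\<bar> < d"
        show "\<phi> t \<le> \<phi> 0"
          using ymax[of "y + t *\<^sub>R i"] near[OF t] by (simp add: \<phi>w)
        show "(\<phi> has_real_derivative \<phi>' t) (at t)"
          unfolding \<phi>_def
          by (rule derivative_eq_intros hd line[OF smu nS[OF t]] line[OF smv nS[OF t]] refl)+
             (simp add: \<phi>'_def algebra_simps)
      next
        show "(\<phi>' has_real_derivative c) (at 0)"
          unfolding \<phi>'_def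
          by (rule derivative_eq_intros hd h'd line[OF smu nS] line[OF smv nS]
                line[OF smooth_on_dir_deriv[OF smu] nS] line[OF smooth_on_dir_deriv[OF smv] nS] refl | (use d in simp; fail))+
             (simp add: c_def algebra_simps power2_eq_square)
      qed
      \<comment> \<open>\<open>16 \<eta> (z \<bullet> i) v D\<^sub>i v \<le> 2 \<eta>\<^sup>2 (D\<^sub>i v)\<^sup>2 + 32 (z \<bullet> i)\<^sup>2 v\<^sup>2\<close>\<close>
      moreover have "0 \<le> 2 * (\<eta> y * dir_deriv i v y - 4 * (z \<bullet> i) * v y)\<^sup>2" by simp
      ultimately show ?thesis
        by (simp add: c_def h_def h'_def algebra_simps power2_eq_square)
    qed
    \<comment> \<open>summing over the axes makes the two Laplacians appear, and these vanish\<close>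
    have "0 \<ge> (\<Sum>i\<in>Basis. (- 24 * (z \<bullet> i)\<^sup>2 - 4 * \<eta> y) * (v y)\<^sup>2 + 2 * (\<eta> y)\<^sup>2 * v y * dir_deriv i (dir_deriv i v) y
        + 2 * A * (dir_deriv i u y)\<^sup>2 + 2 * A * u y * dir_deriv i (dir_deriv i u) y)"
      by (rule sum_nonpos[OF key])
    also have "(\<Sum>i\<in>Basis. (- 24 * (z \<bullet> i)\<^sup>2 - 4 * \<eta> y) * (v y)\<^sup>2 + 2 * (\<eta> y)\<^sup>2 * v y * dir_deriv i (dir_deriv i v) y
        + 2 * A * (dir_deriv i u y)\<^sup>2 + 2 * A * u y * dir_deriv i (dir_deriv i u) y)
       = (- 24 * (\<Sum>i\<in>Basis. (z \<bullet> i)\<^sup>2) - 4 * N * \<eta> y) * (v y)\<^sup>2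
        + 2 * (\<eta> y)\<^sup>2 * v y * laplacian v y
        + 2 * A * (\<Sum>i\<in>Basis. (dir_deriv i u y)\<^sup>2) + 2 * A * u y * laplacian u y"
      by (simp add: laplacian_def N_def sum.distrib sum_distrib_left sum_distrib_right sum_subtractf
          left_diff_distrib sum_negf algebra_simps)
    also have "\<dots> = (- 24 * (z \<bullet> z) - 4 * N * \<eta> y) * (v y)\<^sup>2 + 2 * A * (\<Sum>i\<in>Basis. (dir_deriv i u y)\<^sup>2)"
      using u v yS euclidean_inner[of z z] by (simp add: harmonic_on_def power2_eq_square)
    also have "\<dots> \<ge> (- 24 * (z \<bullet> z) - 4 * N * \<eta> y) * (v y)\<^sup>2 + 2 * A * (v y)\<^sup>2"
      using directional_derivative_le_gradient[OF smooth_on_differentiable[OF smu yS] e] A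
      by (simp add: v_def)
    finally have "(2 * A - 24 * (z \<bullet> z) - 4 * N * \<eta> y) * (v y)\<^sup>2 \<le> 0"
      by (simp add: algebra_simps)
    then have "2 * A \<le> 24 * (z \<bullet> z) + 4 * N * \<eta> y"
      using False by (simp add: mult_le_0_iff)
    also have "\<dots> \<le> 24 * r\<^sup>2 + 4 * N * r\<^sup>2"
      using zr N \<eta>y by (intro add_mono mult_left_mono) auto
    also have "\<dots> < 2 * A" using r by (simp add: A_def algebra_simps)
    finally show ?thesis by simp
  qed
  moreover have "w x0 \<le> w y" using r by (intro ymax) simp
  ultimately have "w x0 \<le> A * M\<^sup>2" by linarith
  moreover have "A * (u x0)\<^sup>2 \<ge> 0" using A by simp
  ultimately have "(r\<^sup>2)\<^sup>2 * (v x0)\<^sup>2 \<le> A * M\<^sup>2" unfolding w_def \<eta>_def by simp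
  then have "r\<^sup>2 * (r\<^sup>2 * (v x0)\<^sup>2) \<le> r\<^sup>2 * ((2 * N + 13) * M\<^sup>2)"
    by (simp add: A_def power2_eq_square mult.assoc)
  then have "r\<^sup>2 * (v x0)\<^sup>2 \<le> (2 * N + 13) * M\<^sup>2"
    using r(1) by (subst (asm) mult_le_cancel_left_pos) simp_all
  then have "(r * \<bar>v x0\<bar>)\<^sup>2 \<le> (sqrt (2 * N + 13) * M)\<^sup>2"
    using N by (simp add: power_mult_distrib)
  then have "r * \<bar>v x0\<bar> \<le> sqrt (2 * N + 13) * M"
    by (rule power2_le_imp_le) (use M0 N in simp)
  then show ?thesis using r by (simp add: v_def N_def field_simps)
qed

text \<open>
  Derivatives of harmonic functions are harmonic, so the gradient bound can be repeated, each time
  on a ball whose radius is smaller by \<open>\<delta>\<close>.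
\<close>

lemma harmonic_iterated_derivative_bound:
  fixes u :: "'a::euclidean_space \<Rightarrow> real"
  assumes S: "open S" and u: "harmonic_on u S" and R: "cball x0 R \<subseteq> S"
    and M: "\<And>x. x \<in> cball x0 R \<Longrightarrow> \<bar>u x\<bar> \<le> M" and e: "norm e = 1" and \<delta>: "0 < \<delta>"
  shows "x \<in> cball x0 (R - j * \<delta>) \<Longrightarrow>
    \<bar>(dir_deriv e ^^ j) u x\<bar> \<le> (sqrt (2 * DIM('a) + 13) / \<delta>) ^ j * M"
proof (induction j arbitrary: x)
  case 0
  then show ?case using M by simp
next
  case (Suc j)
  have harm: "harmonic_on ((dir_deriv e ^^ j) u) S"
    by (induction j) (auto simp: u intro: harmonic_on_dir_deriv[OF S])
  have sub: "cball x \<delta> \<subseteq> cball x0 (R - j * \<delta>)"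
  proof
    fix q assume "q \<in> cball x \<delta>"
    then show "q \<in> cball x0 (R - j * \<delta>)"
      using Suc.prems dist_triangle[of x0 q x] by (simp add: algebra_simps)
  qed
  have "R - j * \<delta> \<le> R" using \<delta> by simp
  then have subS: "cball x \<delta> \<subseteq> S" using sub R subset_cball[of "R - j * \<delta>" R x0] by blast
  have "\<bar>dir_deriv e ((dir_deriv e ^^ j) u) x\<bar>
      \<le> sqrt (2 * DIM('a) + 13) / \<delta> * ((sqrt (2 * DIM('a) + 13) / \<delta>) ^ j * M)"
    by (rule harmonic_gradient_bound[OF S harm \<delta> subS _ e]) (use sub Suc.IH in blast)
  then show ?case by (simp add: mult.assoc)
qed

text \<open>
  The term of index \<open>n\<close> in the exponential series of \<open>exp n\<close> is at most \<open>exp n \<le> 3 ^ n\<close>.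
\<close>

lemma power_self_le_fact: "real n ^ n \<le> 3 ^ n * fact n"
proof -
  have sums: "(\<lambda>k. real n ^ k /\<^sub>R fact k) sums exp (real n)" by (rule exp_converges)
  have "(\<Sum>k\<in>{n}. real n ^ k /\<^sub>R fact k) \<le> exp (real n)"
    using sum_le_suminf[of "\<lambda>k. real n ^ k /\<^sub>R fact k" "{n}"] sums by (simp add: sums_iff)
  also have "exp (real n) = exp 1 ^ n" using exp_of_nat_mult[of n "1::real"] by simp
  also have "\<dots> \<le> 3 ^ n" using exp_le by (intro power_mono) auto
  finally show ?thesis by (simp add: field_simps)
qed

text \<open>
  The Taylor polynomials of \<open>u\<close> at \<open>x0\<close> along the segment to \<open>y\<close> vanish. Dividing the radius into
  steps \<open>\<delta> = R / (2 n)\<close> bounds the derivative of order \<open>n\<close> on half the ball by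
  \<open>(2 n C / R) ^ n M\<close>, so the remainder is at most \<open>(6 C s / R) ^ n M\<close> at distance \<open>s\<close>. What matters
  for the identity theorem is that the radius of the ball reached is a fixed fraction of \<open>R\<close>.
\<close>

lemma harmonic_vanish_near:
  fixes u :: "'a::euclidean_space \<Rightarrow> real"
  assumes S: "open S" and u: "harmonic_on u S" and R: "0 < R" "cball x0 R \<subseteq> S"
    and T: "open T" "x0 \<in> T" "\<And>x. x \<in> T \<Longrightarrow> u x = 0"
    and y: "dist x0 y < R / (6 * sqrt (2 * DIM('a) + 13))"
  shows "u y = 0"
proof (cases "y = x0")
  case True
  then show ?thesis using T by simp
next
  case False
  define C where "C = sqrt (2 * DIM('a) + 13)"
  have "sqrt 1 \<le> C" unfolding C_def by (rule real_sqrt_le_mono) simp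
  then have C: "C \<ge> 1" by simp
  define s where "s = norm (y - x0)"
  have "s < R / (6 * C)"
    using y unfolding s_def C_def dist_norm norm_minus_commute[of x0] .
  then have s: "s > 0" "6 * C * s < R"
    using False C by (auto simp: s_def field_simps)
  have sR: "s \<le> R / 2" using s C R mult_right_mono[OF C, of s] by linarith
  define e where "e = (y - x0) /\<^sub>R s"
  have e: "norm e = 1" using s by (simp add: e_def s_def)
  have ye: "y = x0 + s *\<^sub>R e" using s by (simp add: e_def)
  have smu: "smooth_on u S" using u by (simp add: harmonic_on_def)
  have "continuous_on (cball x0 R) u" using smooth_on_continuous[OF smu] R continuous_on_subset by blast
  then have "bounded (u ` cball x0 R)" by (intro compact_imp_bounded compact_continuous_image compact_cball)
  then obtain M where M: "\<And>x. x \<in> cball x0 R \<Longrightarrow> \<bar>u x\<bar> \<le> M"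
    unfolding bounded_iff by (metis imageI real_norm_def)
  define diff where "diff m t = (dir_deriv e ^^ m) u (x0 + t *\<^sub>R e)" for m t
  have zero: "diff m 0 = 0" for m
  proof -
    have "(dir_deriv e ^^ m) u x = 0" if "x \<in> T" for x
      using that
    proof (induction m arbitrary: x)
      case (Suc m)
      then have "dir_deriv e ((dir_deriv e ^^ m) u) x = dir_deriv e (\<lambda>_. 0) x"
        by (intro dir_deriv_cong[OF T(1)])
      then show ?case by simp
    qed (use T in simp)
    then show ?thesis using T by (simp add: diff_def)
  qed
  have smd: "smooth_on ((dir_deriv e ^^ m) u) S" for m
    by (induction m) (auto simp: smu intro: smooth_on_dir_deriv)
  have inS: "x0 + t *\<^sub>R e \<in> S" if "0 \<le> t" "t \<le> s" for t
    using that sR R e by (intro subsetD[OF R(2)]) (simp add: dist_norm)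
  have der: "\<forall>m t. m < n \<and> 0 \<le> t \<and> t \<le> s \<longrightarrow> DERIV (diff m) t :> diff (Suc m) t" for n
    unfolding diff_def
    using has_real_derivative_along_line[OF smooth_on_differentiable[OF smd inS]] by simp
  have bound: "\<bar>u y\<bar> \<le> (6 * C * s / R) ^ n * M" if n: "n > 0" for n
  proof -
    obtain t where t: "0 < t" "t < s"
      "diff 0 s = (\<Sum>m<n. diff m 0 / fact m * s ^ m) + diff n t / fact n * s ^ n"
      using Maclaurin[OF s(1) n refl der] by blast
    have "x0 + t *\<^sub>R e \<in> cball x0 (R - n * (R / (2 * n)))"
      using t sR n e by (simp add: dist_norm)
    then have "\<bar>diff n t\<bar> \<le> (C / (R / (2 * n))) ^ n * M"
      unfolding diff_def C_def
      using R n by (intro harmonic_iterated_derivative_bound[OF S u R(2) M e]) auto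
    also have "\<dots> = (2 * C / R) ^ n * (real n ^ n * M)"
      by (simp add: power_mult_distrib power_divide)
    also have "\<dots> \<le> (2 * C / R) ^ n * ((3 ^ n * fact n) * M)"
      using power_self_le_fact[of n] M[of x0] C R
      by (intro mult_left_mono mult_right_mono) auto
    also have "\<dots> = (6 * C / R) ^ n * M * fact n"
    proof -
      have "6 * C / R = (2 * C / R) * 3" by simp
      then show ?thesis by (simp only: power_mult_distrib mult_ac)
    qed
    finally have "\<bar>diff n t\<bar> / fact n \<le> (6 * C / R) ^ n * M" by (simp add: field_simps)
    then have "\<bar>diff n t\<bar> / fact n * s ^ n \<le> (6 * C / R) ^ n * M * s ^ n"
      using s by (intro mult_right_mono) auto
    moreover have "\<bar>u y\<bar> = \<bar>diff n t\<bar> / fact n * s ^ n"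
      using t(3) s by (simp add: zero) (simp add: diff_def ye[symmetric] abs_mult)
    ultimately show ?thesis by (simp add: power_mult_distrib power_divide mult_ac)
  qed
  have "(\<lambda>n. (6 * C * s / R) ^ n * M) \<longlonglongrightarrow> 0 * M"
    using s C R by (intro tendsto_mult_right LIMSEQ_power_zero) (simp add: field_simps)
  then have "\<bar>u y\<bar> \<le> 0"
    using bound by (intro LIMSEQ_le_const[where X = "\<lambda>n. (6 * C * s / R) ^ n * M"]) (auto intro!: exI[of _ 1])
  then show ?thesis by simp
qed

text \<open>
  The interior of the zero set is also relatively closed: near a limit point \<open>x\<close> of it, a point \<open>z\<close>
  of it can be chosen so close to \<open>x\<close> that the ball around \<open>z\<close> on which \<open>u\<close> must vanish contains \<open>x\<close>.
\<close>

theorem harmonic_identity: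
  fixes u :: "'a::euclidean_space \<Rightarrow> real"
  assumes S: "open S" "connected S" and u: "harmonic_on u S"
    and T: "open T" "T \<noteq> {}" "T \<subseteq> S" "\<And>x. x \<in> T \<Longrightarrow> u x = 0"
    and x: "x \<in> S"
  shows "u x = 0"
proof -
  define Z where "Z = interior {x \<in> S. u x = 0}"
  have Z: "open Z" "Z \<subseteq> S" "\<And>x. x \<in> Z \<Longrightarrow> u x = 0"
    using interior_subset unfolding Z_def by (blast, blast, blast)
  have "T \<subseteq> Z" unfolding Z_def using T by (intro interior_maximal) auto
  then have "Z \<noteq> {}" using T by blast
  define C where "C = 6 * sqrt (2 * DIM('a) + 13)"
  have C: "C > 0" unfolding C_def by simp
  have "x \<in> Z" if x: "x \<in> S" "x \<in> closure Z" for x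
  proof -
    obtain r where r: "r > 0" "cball x r \<subseteq> S" using open_contains_cball S x by blast
    define d where "d = min (r / 2) (r / 2 / C)"
    have d: "d > 0" "d \<le> r / 2" "d \<le> r / 2 / C" using r C by (auto simp: d_def)
    obtain z where z: "z \<in> Z" "dist z x < d" using x d closure_approachable by blast
    have sub: "cball z (r / 2) \<subseteq> S"
    proof
      fix q assume "q \<in> cball z (r / 2)"
      then have "dist x q \<le> r" using z d dist_triangle[of x q z] by (simp add: dist_commute)
      then show "q \<in> S" using r by auto
    qed
    have "ball z d \<subseteq> {x \<in> S. u x = 0}"
    proof
      fix q assume q: "q \<in> ball z d"
      have "dist z q < r / 2 / (6 * sqrt (2 * DIM('a) + 13))"
        using q d(3) by (simp add: C_def)
      then have "u q = 0"
        using harmonic_vanish_near[OF S(1) u _ sub Z(1) z(1), of q] Z(3) r(1) by simp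
      moreover have "q \<in> S" using q d sub by auto
      ultimately show "q \<in> {x \<in> S. u x = 0}" by simp
    qed
    then have "ball z d \<subseteq> Z" unfolding Z_def by (intro interior_maximal) auto
    then show "x \<in> Z" using z by auto
  qed
  then have "Z = S \<inter> closure Z" using Z(2) closure_subset[of Z] by auto
  then have "closedin (top_of_set S) Z" unfolding closedin_closed using closed_closure by blast
  moreover have "openin (top_of_set S) Z" by (rule open_openin_trans[OF S(1) Z(1,2)])
  ultimately have "Z = S" using S(2) \<open>Z \<noteq> {}\<close> unfolding connected_clopen by blast
  then show ?thesis using Z x by blast
qed

section \<open>Harmonicity of regular functions\<close>

abbreviation coord_dir :: "'n \<Rightarrow> 4 \<Rightarrow> quat ^ 'n" where
  "coord_dir l m \<equiv> axis l (axis m 1)"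

lemma nabla_eq_dir_deriv:
  fixes f :: "quat ^ 'n::finite \<Rightarrow> complex"
  shows "nabla False (l, False) f q = 1/2 * dir_deriv (coord_dir l 1) f q + (-\<i>/2) * dir_deriv (coord_dir l 2) f q"
    and "nabla False (l, True) f q = 1/2 * dir_deriv (coord_dir l 3) f q + \<i>/2 * dir_deriv (coord_dir l 4) f q"
    and "nabla True (l, False) f q = (-1/2) * dir_deriv (coord_dir l 3) f q + \<i>/2 * dir_deriv (coord_dir l 4) f q"
    and "nabla True (l, True) f q = 1/2 * dir_deriv (coord_dir l 1) f q + \<i>/2 * dir_deriv (coord_dir l 2) f q"
  by (simp_all add: pderiv_at_def dir_deriv_def field_simps)

text \<open>Unfolded by the simplifier, the operators would escape the rules below.\<close>

declare nabla.simps [simp del]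

text \<open>
  From this common form the sum, product and quotient rules follow for all \<open>\<nabla>\<close> at once, without a
  case distinction on the indices.
\<close>

lemma nabla_as_combination:
  "\<exists>c d v w. \<forall>f. nabla A' A f = (\<lambda>q::quat ^ 'n::finite. c * dir_deriv v f q + d * dir_deriv w f q)"
proof (cases A)
  case (Pair l b)
  show ?thesis
    unfolding Pair by (induct A'; induct b; intro exI allI ext; rule nabla_eq_dir_deriv)
qed

lemma dir_deriv_combination:
  fixes f g :: "'a::real_normed_vector \<Rightarrow> complex"
  assumes "smooth_on f S" "smooth_on g S" "x \<in> S"
  shows "dir_deriv v (\<lambda>y. c * f y + d * g y) x = c * dir_deriv v f x + d * dir_deriv v g x"
  by (intro dir_deriv_eqI has_derivative_add has_derivative_mult_right differentiable_has_dir_deriv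
        smooth_on_differentiable[OF assms(1,3)] smooth_on_differentiable[OF assms(2,3)])

context
  fixes A' :: bool and A :: "'n::finite \<times> bool"
begin

lemma nabla_cong:
  assumes "open S" "q \<in> S" "\<And>y. y \<in> S \<Longrightarrow> f y = g y"
  shows "nabla A' A f q = nabla A' A g q"
proof -
  obtain c d v w where *: "\<And>f. nabla A' A f = (\<lambda>q. c * dir_deriv v f q + d * dir_deriv w f q)"
    using nabla_as_combination[of A' A] by blast
  show ?thesis unfolding * using dir_deriv_cong[OF assms] by simp
qed

lemma smooth_on_nabla:
  assumes "open S" "smooth_on f S" shows "smooth_on (nabla A' A f) S"
proof -
  obtain c d v w where *: "\<And>f. nabla A' A f = (\<lambda>q. c * dir_deriv v f q + d * dir_deriv w f q)"
    using nabla_as_combination[of A' A] by blast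
  show ?thesis unfolding *
    by (simp add: smooth_on_add smooth_on_mult smooth_on_const smooth_on_dir_deriv assms)
qed

lemma nabla_const [simp]: "nabla A' A (\<lambda>_. c) q = 0"
proof -
  obtain c d v w where *: "\<And>f. nabla A' A f = (\<lambda>q. c * dir_deriv v f q + d * dir_deriv w f q)"
    using nabla_as_combination[of A' A] by blast
  show ?thesis unfolding * by simp
qed

lemma nabla_add:
  assumes "f differentiable (at q)" "g differentiable (at q)"
  shows "nabla A' A (\<lambda>y. f y + g y) q = nabla A' A f q + nabla A' A g q"
proof -
  obtain c d v w where *: "\<And>f. nabla A' A f = (\<lambda>q. c * dir_deriv v f q + d * dir_deriv w f q)"
    using nabla_as_combination[of A' A] by blast
  show ?thesis unfolding * by (simp add: dir_deriv_add assms algebra_simps)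
qed

lemma nabla_mult:
  assumes "f differentiable (at q)" "g differentiable (at q)"
  shows "nabla A' A (\<lambda>y. f y * g y) q = f q * nabla A' A g q + nabla A' A f q * g q"
proof -
  obtain c d v w where *: "\<And>f. nabla A' A f = (\<lambda>q. c * dir_deriv v f q + d * dir_deriv w f q)"
    using nabla_as_combination[of A' A] by blast
  show ?thesis unfolding * by (simp add: dir_deriv_mult assms algebra_simps)
qed

lemma nabla_cmult:
  assumes "f differentiable (at q)"
  shows "nabla A' A (\<lambda>y. c * f y) q = c * nabla A' A f q"
  using nabla_mult[of "\<lambda>_. c" q f] assms by simp

lemma nabla_inverse:
  assumes "f differentiable (at q)" "f q \<noteq> 0"
  shows "nabla A' A (\<lambda>y. inverse (f y)) q = - (inverse (f q))\<^sup>2 * nabla A' A f q"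
proof -
  obtain c d v w where *: "\<And>f. nabla A' A f = (\<lambda>q. c * dir_deriv v f q + d * dir_deriv w f q)"
    using nabla_as_combination[of A' A] by blast
  show ?thesis unfolding * by (simp add: dir_deriv_inverse assms algebra_simps power2_eq_square)
qed

lemma nabla_power:
  assumes "f differentiable (at q)"
  shows "nabla A' A (\<lambda>y. f y ^ n) q = of_nat n * f q ^ (n - 1) * nabla A' A f q"
proof (induction n)
  case (Suc n)
  have "(\<lambda>y. f y ^ n) differentiable (at q)" using assms by (rule differentiable_power)
  then have "nabla A' A (\<lambda>y. f y ^ Suc n) q = f q * nabla A' A (\<lambda>y. f y ^ n) q + nabla A' A f q * f q ^ n"
    using nabla_mult[OF assms] by simp
  also have "\<dots> = of_nat (Suc n) * f q ^ n * nabla A' A f q"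
    unfolding Suc by (cases n) (simp_all add: algebra_simps)
  finally show ?case by simp
qed simp

end

lemma nabla_commute:
  fixes f :: "quat ^ 'n::finite \<Rightarrow> complex"
  assumes f: "smooth_on f S" and S: "open S" "q \<in> S"
  shows "nabla A' A (nabla B' B f) q = nabla B' B (nabla A' A f) q"
proof -
  obtain c d v w where A: "\<And>f. nabla A' A f = (\<lambda>q::quat ^ 'n. c * dir_deriv v f q + d * dir_deriv w f q)"
    using nabla_as_combination[of A' A] by blast
  obtain c' d' v' w' where B: "\<And>f. nabla B' B f = (\<lambda>q::quat ^ 'n. c' * dir_deriv v' f q + d' * dir_deriv w' f q)"
    using nabla_as_combination[of B' B] by blast
  have com: "dir_deriv x (dir_deriv y f) q = dir_deriv y (dir_deriv x f) q" for x y
    by (rule dir_deriv_commute[OF f S])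
  show ?thesis
    unfolding A B by (simp add: dir_deriv_combination[OF smooth_on_dir_deriv[OF f] smooth_on_dir_deriv[OF f] S(2)])
      (simp add: com[of v] com[of w] algebra_simps)
qed

lemma sum_Basis_quat_vec:
  fixes g :: "quat ^ 'n::finite \<Rightarrow> 'b::comm_monoid_add"
  shows "sum g Basis = (\<Sum>l\<in>UNIV. \<Sum>m\<in>UNIV. g (coord_dir l m))"
proof -
  have "bij_betw (\<lambda>(l, m). coord_dir l m) UNIV (Basis :: (quat ^ 'n) set)"
    unfolding bij_betw_def
  proof
    show "inj (\<lambda>(l, m). coord_dir l m :: quat ^ 'n)"
      by (auto simp: inj_def axis_eq_axis)
    show "range (\<lambda>(l, m). coord_dir l m :: quat ^ 'n) = Basis"
      by (force simp: Basis_vec_def)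
  qed
  then have "sum g Basis = (\<Sum>(l, m)\<in>UNIV. g (coord_dir l m))"
    by (simp add: sum.reindex_bij_betw[symmetric] case_prod_beta)
  then show ?thesis by (simp add: sum.cartesian_product UNIV_Times_UNIV[symmetric] del: UNIV_Times_UNIV)
qed

text \<open>
  \<open>\<nabla>\<^sup>0\<^sup>'\<^bsub>2l\<^esub> \<nabla>\<^sup>1\<^sup>'\<^bsub>2l+1\<^esub> - \<nabla>\<^sup>0\<^sup>'\<^bsub>2l+1\<^esub> \<nabla>\<^sup>1\<^sup>'\<^bsub>2l\<^esub>\<close> is a quarter of the Laplacian in the quaternionic
  variable of index \<open>l\<close>.
\<close>

lemma laplacian_eq_nabla:
  fixes f :: "quat ^ 'n::finite \<Rightarrow> complex"
  assumes f: "smooth_on f S" and S: "open S" "q \<in> S"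
  shows "laplacian f q = 4 * (\<Sum>l\<in>UNIV. nabla False (l, False) (nabla True (l, True) f) q
                                    - nabla False (l, True) (nabla True (l, False) f) q)"
proof -
  have com: "dir_deriv x (dir_deriv y f) q = dir_deriv y (dir_deriv x f) q" for x y
    by (rule dir_deriv_commute[OF f S])
  have "4 * (nabla False (l, False) (nabla True (l, True) f) q - nabla False (l, True) (nabla True (l, False) f) q)
      = (\<Sum>m\<in>UNIV. dir_deriv (coord_dir l m) (dir_deriv (coord_dir l m) f) q)" for l
    unfolding nabla_eq_dir_deriv nabla_eq_dir_deriv[abs_def]
      dir_deriv_combination[OF smooth_on_dir_deriv[OF f] smooth_on_dir_deriv[OF f] S(2)]
    by (simp add: com[of "coord_dir l 2" "coord_dir l 1"] com[of "coord_dir l 4" "coord_dir l 3"] sum_4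
          algebra_simps)
  then show ?thesis
    by (simp add: laplacian_def sum_Basis_quat_vec sum_distrib_left)
qed

lemma d_op_form_of_poly:
  fixes f :: "quat ^ 'n::finite \<Rightarrow> nat \<Rightarrow> nat \<Rightarrow> complex"
  shows "d_op A' (\<lambda>y. form_of_poly (f y)) q a b {A} = nabla A' A (\<lambda>y. f y a b) q"
    and "(\<And>A. S \<noteq> {A}) \<Longrightarrow> d_op A' (\<lambda>y. form_of_poly (f y)) q a b S = 0"
proof -
  have none: "{B. B = A \<and> gen_idx B < gen_idx A} = {}" by auto
  show "d_op A' (\<lambda>y. form_of_poly (f y)) q a b {A} = nabla A' A (\<lambda>y. f y a b) q"
    by (simp add: d_op_def form_of_poly_def none)
next
  assume S: "\<And>A. S \<noteq> {A}"
  have "nabla A' A (\<lambda>y. form_of_poly (f y) a b (S - {A})) q = 0" if "A \<in> S" for A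
  proof -
    have "S - {A} \<noteq> {}" using S[of A] that by blast
    then show ?thesis by (simp add: form_of_poly_def)
  qed
  then show "d_op A' (\<lambda>y. form_of_poly (f y)) q a b S = 0" by (simp add: d_op_def)
qed

text \<open>
  Only one-element sets \<open>S\<close> contribute, since \<open>f\<close> is a form of degree 0 and the operator has order 1.
\<close>

lemma cauchy_fueter_eq_0_iff:
  fixes f :: "quat ^ 'n::finite \<Rightarrow> nat \<Rightarrow> nat \<Rightarrow> complex"
  assumes "k \<noteq> 0"
  shows "(\<forall>S. cauchy_fueter k (\<lambda>y. form_of_poly (f y)) q a b S = 0) \<longleftrightarrow>
    (\<forall>A. of_nat (Suc a) * nabla True A (\<lambda>y. f y (Suc a) b) q
        = of_nat (Suc b) * nabla False A (\<lambda>y. f y a (Suc b)) q)" (is "?L \<longleftrightarrow> ?R")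
proof
  assume L: ?L
  show ?R
  proof
    fix A
    show "of_nat (Suc a) * nabla True A (\<lambda>y. f y (Suc a) b) q
        = of_nat (Suc b) * nabla False A (\<lambda>y. f y a (Suc b)) q"
      using spec[OF L, of "{A}"] assms by (simp add: cauchy_fueter_def d_op_form_of_poly(1) del: of_nat_Suc)
  qed
next
  assume R: ?R
  show ?L
  proof
    fix S
    show "cauchy_fueter k (\<lambda>y. form_of_poly (f y)) q a b S = 0"
    proof (cases "\<exists>A. S = {A}")
      case True
      then show ?thesis
        using R assms by (auto simp: cauchy_fueter_def d_op_form_of_poly(1) simp del: of_nat_Suc)
    next
      case False
      then have "S \<noteq> {A}" for A by blast
      then show ?thesis using assms by (simp add: cauchy_fueter_def d_op_form_of_poly(2)[of S])
    qed
  qed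
qed

lemma gen_idx_inj: "gen_idx A = gen_idx B \<Longrightarrow> A = (B :: 'n::finite \<times> bool)"
proof -
  assume "gen_idx A = gen_idx B"
  then have "to_nat (fst A) = to_nat (fst B) \<and> snd A = snd B"
    unfolding gen_idx_def by (cases "snd A"; cases "snd B"; simp; presburger)
  then show ?thesis by (simp add: prod_eq_iff)
qed

lemma cauchy_fueter_0_pair:
  fixes f :: "quat ^ 'n::finite \<Rightarrow> nat \<Rightarrow> nat \<Rightarrow> complex"
  assumes "gen_idx A < gen_idx B"
  shows "cauchy_fueter 0 (\<lambda>y. form_of_poly (f y)) q a b {A, B}
    = nabla False A (nabla True B (\<lambda>y. f y a b)) q - nabla False B (nabla True A (\<lambda>y. f y a b)) q"
proof -
  have ne: "A \<noteq> B" using assms by auto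
  then have diff: "{A, B} - {A} = {B}" "{A, B} - {B} = {A}" by auto
  have signs: "{C \<in> {A, B}. gen_idx C < gen_idx A} = {}" "{C \<in> {A, B}. gen_idx C < gen_idx B} = {A}"
    using assms by auto
  have pair: "sum t {A, B} = t A + t B" for t :: "_ \<Rightarrow> complex" using ne by simp
  have "cauchy_fueter 0 (\<lambda>y. form_of_poly (f y)) q a b {A, B}
      = d_op False (d_op True (\<lambda>y. form_of_poly (f y))) q a b {A, B}"
    by (simp add: cauchy_fueter_def)
  also have "\<dots> = nabla False A (nabla True B (\<lambda>y. f y a b)) q - nabla False B (nabla True A (\<lambda>y. f y a b)) q"
    unfolding d_op_def[of False] pair diff signs d_op_form_of_poly(1) by simp
  finally show ?thesis .
qed

text \<open>
  Here only two-element sets contribute. The equation is antisymmetric in the two indices, so the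
  order of the generators does not show in the result.
\<close>

lemma cauchy_fueter_0_eq_0_iff:
  fixes f :: "quat ^ 'n::finite \<Rightarrow> nat \<Rightarrow> nat \<Rightarrow> complex"
  shows "(\<forall>S. cauchy_fueter 0 (\<lambda>y. form_of_poly (f y)) q a b S = 0) \<longleftrightarrow>
    (\<forall>A B. nabla False A (nabla True B (\<lambda>y. f y a b)) q = nabla False B (nabla True A (\<lambda>y. f y a b)) q)"
    (is "?L \<longleftrightarrow> ?R")
proof
  assume L: ?L
  show ?R
  proof (intro allI)
    fix A B :: "'n \<times> bool"
    consider "A = B" | "gen_idx A < gen_idx B" | "gen_idx B < gen_idx A"
      using gen_idx_inj[of A B] by linarith
    then show "nabla False A (nabla True B (\<lambda>y. f y a b)) q = nabla False B (nabla True A (\<lambda>y. f y a b)) q"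
      by cases (use L cauchy_fueter_0_pair[of A B f q a b] cauchy_fueter_0_pair[of B A f q a b] in auto)
  qed
next
  assume R: ?R
  show ?L
  proof
    fix S
    show "cauchy_fueter 0 (\<lambda>y. form_of_poly (f y)) q a b S = 0"
    proof (cases "\<exists>A B. A \<noteq> B \<and> S = {A, B}")
      case True
      then obtain A B where AB: "A \<noteq> B" "S = {A, B}" by blast
      then consider "gen_idx A < gen_idx B" | "gen_idx B < gen_idx A"
        using gen_idx_inj[of A B] by linarith
      then show ?thesis
      proof cases
        case 1
        then show ?thesis using cauchy_fueter_0_pair[OF 1, of f q a b] R AB(2) by simp
      next
        case 2
        then show ?thesis using cauchy_fueter_0_pair[OF 2, of f q a b] R AB(2) by (simp add: insert_commute)
      qed
    next
      case False
      have "S - {A} \<noteq> {B}" if "A \<in> S" for A B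
        using False that by (metis Diff_iff insertI1 insert_Diff singletonI)
      then show ?thesis
        by (simp add: cauchy_fueter_def d_op_def[of False] d_op_form_of_poly(2))
    qed
  qed
qed

text \<open>
  If \<open>\<nabla>\<^sup>A\<^sup>'\<close> of \<open>w\<close> is, up to a constant, the opposite \<open>\<nabla>\<close> of some \<open>u\<close> for all lower indices, then
  both terms of the Laplacian of \<open>w\<close> become second derivatives of \<open>u\<close> with the same primed index
  twice; these agree because such operators commute.
\<close>

lemma laplacian_eq_0_of_nabla_pair:
  fixes u w :: "quat ^ 'n::finite \<Rightarrow> complex"
  assumes S: "open S" "q \<in> S" and u: "smooth_on u S" and w: "smooth_on w S"
    and eq: "\<And>A y. y \<in> S \<Longrightarrow> nabla A' A w y = c * nabla (\<not> A') A u y"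
  shows "laplacian w q = 0"
proof -
  have twice: "nabla B' B (nabla A' A w) q = c * nabla B' B (nabla (\<not> A') A u) q" for B' A B
    using nabla_cong[OF S, of "nabla A' A w" "\<lambda>y. c * nabla (\<not> A') A u y"] eq
      nabla_cmult[OF smooth_on_differentiable[OF smooth_on_nabla[OF S(1) u] S(2)]] by metis
  have com: "nabla B' B (nabla C' C w) q = nabla C' C (nabla B' B w) q"
            "nabla B' B (nabla C' C u) q = nabla C' C (nabla B' B u) q" for B' B C' C
    by (rule nabla_commute[OF w S], rule nabla_commute[OF u S])
  have "nabla False (l, False) (nabla True (l, True) w) q = nabla False (l, True) (nabla True (l, False) w) q" for l
  proof (cases A')
    case True
    then show ?thesis using twice[of False "(l, False)" "(l, True)"] twice[of False "(l, True)" "(l, False)"]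
      com(2)[of False "(l, True)" False "(l, False)"] by simp
  next
    case False
    then show ?thesis using twice[of True "(l, True)" "(l, False)"] twice[of True "(l, False)" "(l, True)"]
      com(2)[of True "(l, True)" True "(l, False)"]
      com(1)[of True "(l, True)" False "(l, False)"] com(1)[of True "(l, False)" False "(l, True)"] by simp
  qed
  then show ?thesis by (simp add: laplacian_eq_nabla[OF w S])
qed

text \<open>
  For \<open>k = 0\<close> the Laplacian is a sum of components of the equation itself. For \<open>k \<ge> 1\<close> every coefficient
  has a neighbour, obtained by moving one power from \<open>s\<^sub>0\<^sub>'\<close> to \<open>s\<^sub>1\<^sub>'\<close> or back, to which the first order
  equations link it.
\<close>

theorem k_regular_harmonic:
  fixes f :: "quat ^ 'n::finite \<Rightarrow> nat \<Rightarrow> nat \<Rightarrow> complex"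
  assumes S: "open S" and f: "f \<in> k_regular_fns k S" and ab: "a + b = k"
  shows "harmonic_on (\<lambda>q. f q a b) S"
  unfolding harmonic_on_def
proof (intro conjI ballI)
  have sm: "smooth_on (\<lambda>q. f q a b) S" for a b using f by (simp add: k_regular_fns_def)
  then show "smooth_on (\<lambda>q. f q a b) S" .
  have reg: "\<forall>S. cauchy_fueter k (\<lambda>y. form_of_poly (f y)) q a b S = 0" if "q \<in> S" for q a b
    using f that by (simp add: k_regular_fns_def)
  fix q assume q: "q \<in> S"
  show "laplacian (\<lambda>q. f q a b) q = 0"
  proof (cases "k = 0")
    case True
    then show ?thesis
      using reg[OF q] by (simp add: laplacian_eq_nabla[OF sm S q] cauchy_fueter_0_eq_0_iff)
  next
    case False
    have eq: "of_nat (Suc a) * nabla True A (\<lambda>y. f y (Suc a) b) q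
        = of_nat (Suc b) * nabla False A (\<lambda>y. f y a (Suc b)) q" if "q \<in> S" for A q a b
      using reg[OF that] unfolding cauchy_fueter_eq_0_iff[OF False] by blast
    show ?thesis
    proof (cases a)
      case (Suc a')
      show ?thesis
        by (rule laplacian_eq_0_of_nabla_pair[OF S q sm[of a' "Suc b"] sm[of a b], of True "complex_of_nat (Suc b) / complex_of_nat (Suc a')"])
           (use eq[of _ a' _ b] in \<open>simp add: Suc field_simps del: of_nat_Suc\<close>)
    next
      case 0
      then obtain b' where b': "b = Suc b'" using ab False by (cases b) auto
      show ?thesis
        by (rule laplacian_eq_0_of_nabla_pair[OF S q sm[of "Suc a" b'] sm[of a b], of False "complex_of_nat (Suc a) / complex_of_nat (Suc b')"])
           (use eq[of _ a _ b'] in \<open>simp add: b' field_simps del: of_nat_Suc\<close>)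
    qed
  qed
qed

theorem k_regular_identity:
  fixes f g :: "quat ^ 'n::finite \<Rightarrow> nat \<Rightarrow> nat \<Rightarrow> complex"
  assumes S: "open S" "connected S" and f: "f \<in> k_regular_fns k S" and g: "g \<in> k_regular_fns k S"
    and T: "open T" "T \<noteq> {}" "T \<subseteq> S" "\<And>q. q \<in> T \<Longrightarrow> f q = g q" and q: "q \<in> S"
  shows "f q = g q"
proof (intro ext)
  fix a b
  show "f q a b = g q a b"
  proof (cases "a + b = k")
    case False
    then show ?thesis using f g q by (simp add: k_regular_fns_def)
  next
    case True
    have "L (f q a b) = L (g q a b)" if L: "bounded_linear L" for L :: "complex \<Rightarrow> real"
    proof -
      have h: "harmonic_on (\<lambda>q. L (f q a b)) S" if "f \<in> k_regular_fns k S" for f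
        using k_regular_harmonic[OF S(1) that True]
          smooth_on_linear_compose[OF L, of "\<lambda>q. f q a b" S] S(1)
        by (simp add: harmonic_on_def laplacian_def dir_deriv2_linear_compose[OF L _ S(1)]
              linear_sum[OF bounded_linear.linear[OF L], symmetric] linear_0[OF bounded_linear.linear[OF L]])
      have "harmonic_on (\<lambda>q. L (f q a b) - L (g q a b)) S"
        by (rule harmonic_on_diff[OF S(1) h[OF f] h[OF g]])
      then have "L (f q a b) - L (g q a b) = 0"
        by (rule harmonic_identity[OF S _ T(1-3) _ q]) (simp add: T(4))
      then show ?thesis by simp
    qed
    from this[OF bounded_linear_Re] this[OF bounded_linear_Im] show ?thesis by (rule complex_eqI)
  qed
qed

section \<open>A regular function that is singular exactly on a hyperplane\<close>

definition quat_linear :: "quat ^ 'n::finite \<Rightarrow> quat ^ 'n \<Rightarrow> quat" where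
  "quat_linear b q = (\<Sum>l\<in>UNIV. hmult (b $ l) (q $ l))"

text \<open>
  The complex coordinates \<open>\<alpha> = x\<^sub>1 - i x\<^sub>2\<close> and \<open>\<beta> = - x\<^sub>3 + i x\<^sub>4\<close> of a quaternion are chosen so that
  each is annihilated by one of the two families of operators: \<open>\<nabla>\<^sup>0\<^sup>' \<alpha> = 0\<close> and \<open>\<nabla>\<^sup>1\<^sup>' \<beta> = 0\<close>. Left
  multiplication of the variable by a quaternion mixes only the lower index \<open>A\<close>, so this persists for
  the quaternionic affine function \<open>\<xi> = a + b q\<close>.
\<close>

definition quat_alpha :: "quat \<Rightarrow> complex" where "quat_alpha x = Complex (x $ 1) (- x $ 2)"
definition quat_beta :: "quat \<Rightarrow> complex" where "quat_beta x = Complex (- x $ 3) (x $ 4)"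

lemma vector_4_nth:
  "(vector [x, y, z, w] :: 'a::zero ^ 4) $ 1 = x"
  "(vector [x, y, z, w] :: 'a::zero ^ 4) $ 2 = y"
  "(vector [x, y, z, w] :: 'a::zero ^ 4) $ 3 = z"
  "(vector [x, y, z, w] :: 'a::zero ^ 4) $ 4 = w"
  unfolding vector_def by simp_all

lemma linear_hmult: "linear (hmult p)"
  by (rule linearI) (simp_all add: vec_eq_iff forall_4 hmult_def vector_4_nth algebra_simps)

lemma hmult_units:
  "hmult p (axis 1 1) = vector [p $ 1, p $ 2, p $ 3, p $ 4]"
  "hmult p (axis 2 1) = vector [- p $ 2, p $ 1, p $ 4, - p $ 3]"
  "hmult p (axis 3 1) = vector [- p $ 3, - p $ 4, p $ 1, p $ 2]"
  "hmult p (axis 4 1) = vector [- p $ 4, p $ 3, - p $ 2, p $ 1]"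
  by (simp_all add: vec_eq_iff forall_4 hmult_def vector_4_nth axis_def)

lemma bounded_linear_quat_linear: "bounded_linear (quat_linear b)"
  unfolding quat_linear_def [abs_def]
  by (intro bounded_linear_sum bounded_linear_compose[OF _ bounded_linear_vec_nth]
        linear_conv_bounded_linear[THEN iffD1] linear_hmult)

lemma quat_linear_coord_dir: "quat_linear b (coord_dir l m) = hmult (b $ l) (axis m 1)"
proof -
  have "quat_linear b (coord_dir l m) = (\<Sum>j\<in>UNIV. if j = l then hmult (b $ l) (axis m 1) else 0)"
    unfolding quat_linear_def using linear_0[OF linear_hmult]
    by (intro sum.cong) (auto simp: axis_def)
  then show ?thesis by simp
qed

lemma bounded_linear_quat_alpha: "bounded_linear quat_alpha"
  unfolding linear_conv_bounded_linear[symmetric]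
  by (rule linearI) (simp_all add: quat_alpha_def complex_eq_iff)

lemma bounded_linear_quat_beta: "bounded_linear quat_beta"
  unfolding linear_conv_bounded_linear[symmetric]
  by (rule linearI) (simp_all add: quat_beta_def complex_eq_iff)

text \<open>
  In what follows, \<open>\<alpha>\<close>, \<open>\<beta>\<close> and \<open>|\<xi>|\<^sup>2\<close> are taken at \<open>\<xi> = a + b q\<close>. The squared norm has complex
  values because it enters the calculus of the operators \<open>\<nabla>\<close>.
\<close>

context
  fixes a :: quat and b :: "quat ^ 'n::finite"
begin

definition alpha :: "quat ^ 'n \<Rightarrow> complex" where "alpha q = quat_alpha (a + quat_linear b q)"
definition beta :: "quat ^ 'n \<Rightarrow> complex" where "beta q = quat_beta (a + quat_linear b q)"
definition xi_norm2 :: "quat ^ 'n \<Rightarrow> complex" where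
  "xi_norm2 q = alpha q * cnj (alpha q) + beta q * cnj (beta q)"

text \<open>
  The derivatives \<open>\<gamma>\<^sub>A = \<nabla>\<^sup>1\<^sup>'\<^sub>A \<alpha> = - \<nabla>\<^sup>0\<^sup>'\<^sub>A \<beta>\<close> and \<open>\<mu>\<^sub>A = \<nabla>\<^sup>0\<^sup>'\<^sub>A \<alpha>* = \<nabla>\<^sup>1\<^sup>'\<^sub>A \<beta>*\<close>, which are constant because
  \<open>\<xi>\<close> is affine; the star denotes complex conjugation.
\<close>

definition gamma :: "'n \<times> bool \<Rightarrow> complex" where
  "gamma A = (if snd A then quat_alpha (b $ fst A) else - quat_beta (b $ fst A))"
definition mu :: "'n \<times> bool \<Rightarrow> complex" where
  "mu A = (if snd A then cnj (quat_beta (b $ fst A)) else cnj (quat_alpha (b $ fst A)))"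

lemma xi_norm2_eq: "xi_norm2 q = of_real ((cmod (alpha q))\<^sup>2 + (cmod (beta q))\<^sup>2)"
  by (simp add: xi_norm2_def complex_norm_square[symmetric])

lemma xi_norm2_eq_0_iff: "xi_norm2 q = 0 \<longleftrightarrow> q \<in> quat_hyperplane a b"
proof -
  have "xi_norm2 q = 0 \<longleftrightarrow> (cmod (alpha q))\<^sup>2 + (cmod (beta q))\<^sup>2 = 0"
    unfolding xi_norm2_eq by (rule of_real_eq_0_iff)
  also have "\<dots> \<longleftrightarrow> alpha q = 0 \<and> beta q = 0" by (simp add: sum_power2_eq_zero_iff)
  also have "\<dots> \<longleftrightarrow> a + quat_linear b q = 0"
    by (auto simp: alpha_def beta_def quat_alpha_def quat_beta_def vec_eq_iff forall_4 complex_eq_iff)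
  finally show ?thesis by (simp add: quat_hyperplane_def quat_linear_def)
qed

lemma alpha_affine: "alpha q = quat_alpha a + quat_alpha (quat_linear b q)"
  and beta_affine: "beta q = quat_beta a + quat_beta (quat_linear b q)"
  by (simp_all add: alpha_def beta_def quat_alpha_def quat_beta_def complex_eq_iff)

lemma bounded_linear_alpha: "bounded_linear (\<lambda>q. quat_alpha (quat_linear b q))"
  and bounded_linear_beta: "bounded_linear (\<lambda>q. quat_beta (quat_linear b q))"
  by (rule bounded_linear_compose[OF bounded_linear_quat_alpha bounded_linear_quat_linear]
      bounded_linear_compose[OF bounded_linear_quat_beta bounded_linear_quat_linear])+

lemma dir_deriv_alpha: "dir_deriv v alpha q = quat_alpha (quat_linear b v)"
  and dir_deriv_beta: "dir_deriv v beta q = quat_beta (quat_linear b v)"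
  unfolding alpha_affine[abs_def] beta_affine[abs_def]
  by (rule dir_deriv_eqI; auto intro!: derivative_eq_intros
        bounded_linear.has_derivative[OF bounded_linear_alpha] bounded_linear.has_derivative[OF bounded_linear_beta])+

lemma smooth_on_alpha: "open S \<Longrightarrow> smooth_on alpha S"
  and smooth_on_beta: "open S \<Longrightarrow> smooth_on beta S"
  unfolding alpha_affine[abs_def] beta_affine[abs_def]
  by (rule smooth_on_affine[OF bounded_linear_alpha], assumption)
     (rule smooth_on_affine[OF bounded_linear_beta], assumption)

lemma smooth_on_xi_norm2: "open S \<Longrightarrow> smooth_on xi_norm2 S"
  unfolding xi_norm2_def [abs_def]
  by (intro smooth_on_add smooth_on_mult smooth_on_linear_compose[OF bounded_linear_cnj]
        smooth_on_alpha smooth_on_beta)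

lemma differentiable_alpha [simp]: "alpha differentiable (at q)"
  and differentiable_beta [simp]: "beta differentiable (at q)"
  and differentiable_xi_norm2 [simp]: "xi_norm2 differentiable (at q)"
  and differentiable_cnj_alpha [simp]: "(\<lambda>y. cnj (alpha y)) differentiable (at q)"
  and differentiable_cnj_beta [simp]: "(\<lambda>y. cnj (beta y)) differentiable (at q)"
  using smooth_on_alpha[OF open_UNIV] smooth_on_beta[OF open_UNIV] smooth_on_xi_norm2[OF open_UNIV]
    smooth_on_linear_compose[OF bounded_linear_cnj smooth_on_alpha[OF open_UNIV] open_UNIV]
    smooth_on_linear_compose[OF bounded_linear_cnj smooth_on_beta[OF open_UNIV] open_UNIV]
  by (auto dest: smooth_on_differentiable)

lemma differentiable_inverse_xi_norm2 [simp]: "xi_norm2 q \<noteq> 0 \<Longrightarrow> (\<lambda>y. inverse (xi_norm2 y)) differentiable (at q)"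
  by (rule differentiable_inverse_field) simp_all

lemma nabla_alpha: "nabla A' A alpha q = (if A' then gamma A else 0)"
  and nabla_beta: "nabla A' A beta q = (if A' then 0 else - gamma A)"
  and nabla_cnj_alpha: "nabla A' A (\<lambda>y. cnj (alpha y)) q = (if A' then 0 else mu A)"
  and nabla_cnj_beta: "nabla A' A (\<lambda>y. cnj (beta y)) q = (if A' then mu A else 0)"
proof -
  obtain l c where A: "A = (l, c)" by (cases A)
  note d = nabla_eq_dir_deriv dir_deriv_linear_compose[OF bounded_linear_cnj differentiable_alpha]
    dir_deriv_linear_compose[OF bounded_linear_cnj differentiable_beta] dir_deriv_alpha dir_deriv_beta
    quat_linear_coord_dir hmult_units vector_4_nth quat_alpha_def quat_beta_def gamma_def mu_def complex_eq_iff
  show "nabla A' A alpha q = (if A' then gamma A else 0)"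
    unfolding A by (induct A'; induct c) (simp_all add: d)
  show "nabla A' A beta q = (if A' then 0 else - gamma A)"
    unfolding A by (induct A'; induct c) (simp_all add: d)
  show "nabla A' A (\<lambda>y. cnj (alpha y)) q = (if A' then 0 else mu A)"
    unfolding A by (induct A'; induct c) (simp_all add: d)
  show "nabla A' A (\<lambda>y. cnj (beta y)) q = (if A' then mu A else 0)"
    unfolding A by (induct A'; induct c) (simp_all add: d)
qed

lemma nabla_xi_norm2: "nabla A' A xi_norm2 q
    = (if A' then gamma A * cnj (alpha q) + mu A * beta q else mu A * alpha q - gamma A * cnj (beta q))"
  unfolding xi_norm2_def [abs_def]
  by (simp add: nabla_add nabla_mult nabla_alpha nabla_beta nabla_cnj_alpha nabla_cnj_beta
      differentiable_mult)

text \<open>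
  The coefficients of \<open>(s\<^sub>0\<^sub>' \<alpha> + s\<^sub>1\<^sub>' \<beta>)\<^sup>k / |\<xi>|\<^bsup>2k+2\<^esup>\<close>. For \<open>\<xi> = q\<close> and \<open>k = 0\<close> this is a multiple of
  the fundamental solution of the Laplacian on \<open>\<real>\<^sup>4\<close>. Applying \<open>\<nabla>\<^sup>0\<^sup>'\<close> and \<open>\<nabla>\<^sup>1\<^sup>'\<close> with lower index 0 to
  it, \<open>k\<close> times in all, yields the coefficients for general \<open>k\<close> up to constants.
\<close>

definition singular_solution :: "nat \<Rightarrow> quat ^ 'n \<Rightarrow> nat \<Rightarrow> nat \<Rightarrow> complex" where
  "singular_solution k q i j = (if i + j = k
     then of_nat (k choose i) * (alpha q ^ i * beta q ^ j * inverse (xi_norm2 q) ^ Suc k) else 0)"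

lemma nabla_monomial:
  assumes "xi_norm2 q \<noteq> 0"
  shows "nabla A' A (\<lambda>y. alpha y ^ i * beta y ^ j * inverse (xi_norm2 y) ^ Suc k) q
    = alpha q ^ i * beta q ^ j * (of_nat (Suc k) * inverse (xi_norm2 q) ^ k * (- (inverse (xi_norm2 q))\<^sup>2 * nabla A' A xi_norm2 q))
    + (alpha q ^ i * (of_nat j * beta q ^ (j - 1) * nabla A' A beta q)
       + of_nat i * alpha q ^ (i - 1) * nabla A' A alpha q * beta q ^ j) * inverse (xi_norm2 q) ^ Suc k"
  using assms
  by (simp add: nabla_mult nabla_power nabla_inverse differentiable_mult differentiable_power
      del: of_nat_Suc power_Suc)

text \<open>
  The binomial coefficients turn the equations for \<open>k \<ge> 1\<close> into this relation between neighbouring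
  monomials. After the common factor is removed, it says
  \<open>(k + 1) \<gamma>\<^sub>A (1 - I (\<alpha> \<alpha>* + \<beta> \<beta>*)) = 0\<close> with \<open>I = |\<xi>|\<^bsup>-2\<^esup>\<close>, because
  \<open>\<alpha> \<nabla>\<^sup>1\<^sup>'\<^sub>A |\<xi>|\<^sup>2 - \<beta> \<nabla>\<^sup>0\<^sup>'\<^sub>A |\<xi>|\<^sup>2 = \<gamma>\<^sub>A |\<xi>|\<^sup>2\<close>.
\<close>

lemma first_order_equation:
  assumes nz: "xi_norm2 q \<noteq> 0" and ij: "Suc (i + j) = k"
  shows "nabla True A (\<lambda>y. alpha y ^ Suc i * beta y ^ j * inverse (xi_norm2 y) ^ Suc k) q
       = nabla False A (\<lambda>y. alpha y ^ i * beta y ^ Suc j * inverse (xi_norm2 y) ^ Suc k) q"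
proof -
  define P where "P = alpha q ^ i * beta q ^ j * inverse (xi_norm2 q) ^ Suc k"
  define I where "I = inverse (xi_norm2 q)"
  have I: "I * (alpha q * cnj (alpha q) + beta q * cnj (beta q)) = 1"
    unfolding I_def xi_norm2_def[symmetric] using nz by simp
  have k: "(of_nat (Suc k) :: complex) = of_nat (Suc i) + of_nat (Suc j)"
    using ij by auto
  have "nabla True A (\<lambda>y. alpha y ^ Suc i * beta y ^ j * inverse (xi_norm2 y) ^ Suc k) q
      = P * (of_nat (Suc i) * gamma A - of_nat (Suc k) * alpha q * I * (gamma A * cnj (alpha q) + mu A * beta q))"
    unfolding nabla_monomial[OF nz] nabla_xi_norm2 nabla_alpha nabla_beta P_def I_def
    by (simp add: algebra_simps power2_eq_square del: of_nat_Suc)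
  moreover have "nabla False A (\<lambda>y. alpha y ^ i * beta y ^ Suc j * inverse (xi_norm2 y) ^ Suc k) q
      = P * (- of_nat (Suc j) * gamma A - of_nat (Suc k) * beta q * I * (mu A * alpha q - gamma A * cnj (beta q)))"
    unfolding nabla_monomial[OF nz] nabla_xi_norm2 nabla_alpha nabla_beta P_def I_def
    by (simp add: algebra_simps power2_eq_square del: of_nat_Suc)
  moreover have "(of_nat (Suc i) * gamma A - of_nat (Suc k) * alpha q * I * (gamma A * cnj (alpha q) + mu A * beta q))
      - (- of_nat (Suc j) * gamma A - of_nat (Suc k) * beta q * I * (mu A * alpha q - gamma A * cnj (beta q)))
      = of_nat (Suc k) * gamma A * (1 - I * (alpha q * cnj (alpha q) + beta q * cnj (beta q)))"
    unfolding k by (simp add: algebra_simps)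
  ultimately show ?thesis unfolding I by simp
qed

text \<open>
  This is the equation for \<open>k = 0\<close>. Antisymmetrized in the two lower indices, the term with the
  product of two first derivatives of \<open>|\<xi>|\<^sup>2\<close> is a multiple of \<open>|\<xi>|\<^sup>2\<close>, and after cancellation it is opposite
  to the term with the second derivative.
\<close>

lemma second_order_equation:
  assumes nz: "xi_norm2 q \<noteq> 0"
  shows "nabla False A (nabla True B (\<lambda>y. inverse (xi_norm2 y))) q
       = nabla False B (nabla True A (\<lambda>y. inverse (xi_norm2 y))) q"
proof -
  define S where "S = {y. xi_norm2 y \<noteq> 0}"
  have "continuous_on UNIV xi_norm2" by (rule smooth_on_continuous[OF smooth_on_xi_norm2[OF open_UNIV]])
  then have S: "open S" unfolding S_def
    by (rule open_Collect_neq) (rule continuous_on_const)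
  have qS: "q \<in> S" using nz by (simp add: S_def)
  define I where "I = inverse (xi_norm2 q)"
  have I: "I * (alpha q * cnj (alpha q) + beta q * cnj (beta q)) = 1"
    unfolding I_def xi_norm2_def[symmetric] using nz by simp
  have twice: "nabla False A (nabla True B (\<lambda>y. inverse (xi_norm2 y))) q =
      2 * I ^ 3 * (mu A * alpha q - gamma A * cnj (beta q)) * (gamma B * cnj (alpha q) + mu B * beta q)
      - I\<^sup>2 * (gamma B * mu A - mu B * gamma A)" for A B
  proof -
    have "nabla False A (nabla True B (\<lambda>y. inverse (xi_norm2 y))) q
        = nabla False A (\<lambda>y. (-1) * ((inverse (xi_norm2 y))\<^sup>2 * (gamma B * cnj (alpha y) + mu B * beta y))) q"
      by (rule nabla_cong[OF S qS]) (simp add: nabla_inverse nabla_xi_norm2 S_def)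
    also have "\<dots> = (-1) * nabla False A (\<lambda>y. (inverse (xi_norm2 y))\<^sup>2 * (gamma B * cnj (alpha y) + mu B * beta y)) q"
      using nz by (intro nabla_cmult differentiable_mult differentiable_power differentiable_add) simp_all
    also have "\<dots> = 2 * I ^ 3 * (mu A * alpha q - gamma A * cnj (beta q)) * (gamma B * cnj (alpha q) + mu B * beta q)
      - I\<^sup>2 * (gamma B * mu A - mu B * gamma A)"
      using nz
      by (simp add: nabla_cmult nabla_mult nabla_add nabla_power nabla_inverse nabla_cnj_alpha nabla_beta nabla_xi_norm2
          differentiable_mult differentiable_power differentiable_add I_def)
        (simp add: algebra_simps power2_eq_square power3_eq_cube)
    finally show ?thesis .
  qed
  have "nabla False A (nabla True B (\<lambda>y. inverse (xi_norm2 y))) q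
      - nabla False B (nabla True A (\<lambda>y. inverse (xi_norm2 y))) q
    = 2 * I\<^sup>2 * (gamma B * mu A - mu B * gamma A) * (I * (alpha q * cnj (alpha q) + beta q * cnj (beta q)) - 1)"
    unfolding twice by (simp add: algebra_simps power2_eq_square power3_eq_cube)
  then show ?thesis unfolding I by simp
qed

theorem singular_solution_k_regular:
  assumes S: "open S" and nz: "\<And>q. q \<in> S \<Longrightarrow> xi_norm2 q \<noteq> 0"
  shows "singular_solution k \<in> k_regular_fns k S"
  unfolding k_regular_fns_def
proof (intro CollectI conjI ballI allI impI)
  fix q i j assume "i + j \<noteq> k"
  then show "singular_solution k q i j = 0" by (simp add: singular_solution_def)
next
  fix i j
  have "smooth_on (\<lambda>q. of_nat (k choose i) * (alpha q ^ i * beta q ^ j * inverse (xi_norm2 q) ^ Suc k)) S"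
    by (intro smooth_on_mult smooth_on_power smooth_on_const smooth_on_inverse
          smooth_on_alpha smooth_on_beta smooth_on_xi_norm2 S nz)
  then show "smooth_on (\<lambda>q. singular_solution k q i j) S"
    by (cases "i + j = k") (simp_all add: singular_solution_def smooth_on_const[OF S])
next
  fix q i j T assume q: "q \<in> S"
  show "cauchy_fueter k (\<lambda>y. form_of_poly (singular_solution k y)) q i j T = 0"
  proof (cases "k = 0")
    case True
    have "\<forall>A B. nabla False A (nabla True B (\<lambda>y. singular_solution 0 y i j)) q
        = nabla False B (nabla True A (\<lambda>y. singular_solution 0 y i j)) q"
    proof (cases "i = 0 \<and> j = 0")
      case True
      then show ?thesis using second_order_equation[OF nz[OF q]] by (simp add: singular_solution_def)
    next
      case False
      have "nabla A' A (\<lambda>_. 0) = (\<lambda>_. 0)" for A' and A :: "'n \<times> bool" by (rule ext) simp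
      then show ?thesis using False by (auto simp: singular_solution_def)
    qed
    then show ?thesis using True cauchy_fueter_0_eq_0_iff by blast
  next
    case False
    have "of_nat (Suc i) * nabla True A (\<lambda>y. singular_solution k y (Suc i) j) q
        = of_nat (Suc j) * nabla False A (\<lambda>y. singular_solution k y i (Suc j)) q" for A
    proof (cases "Suc (i + j) = k")
      case True
      let ?X = "\<lambda>y. alpha y ^ Suc i * beta y ^ j * inverse (xi_norm2 y) ^ Suc k"
      let ?Y = "\<lambda>y. alpha y ^ i * beta y ^ Suc j * inverse (xi_norm2 y) ^ Suc k"
      have X: "?X differentiable (at q)" and Y: "?Y differentiable (at q)"
        using nz[OF q] by (simp_all add: differentiable_mult differentiable_power del: power_Suc)
      have "Suc i * (k choose Suc i) = Suc j * (k choose i)"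
        using Suc_times_binomial_add[of i j] True by simp
      then have bin: "(of_nat (Suc i) :: complex) * of_nat (k choose Suc i) = of_nat (Suc j) * of_nat (k choose i)"
        by (metis of_nat_mult)
      have "(\<lambda>y. singular_solution k y (Suc i) j) = (\<lambda>y. of_nat (k choose Suc i) * ?X y)"
        "(\<lambda>y. singular_solution k y i (Suc j)) = (\<lambda>y. of_nat (k choose i) * ?Y y)"
        using True by (simp_all add: singular_solution_def)
      then show ?thesis
        using first_order_equation[OF nz[OF q] True, of A] bin
        by (simp only: nabla_cmult[OF X] nabla_cmult[OF Y]) (simp only: mult.assoc[symmetric])
    next
      case False
      then show ?thesis by (simp add: singular_solution_def)
    qed
    then show ?thesis using cauchy_fueter_eq_0_iff[OF False] by blast
  qed
qed

text \<open>
  The solution blows up at the hyperplane: since \<open>|\<alpha>|\<^sup>2 + |\<beta>|\<^sup>2 = |\<xi>|\<^sup>2\<close>, one of the two extreme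
  coefficients \<open>\<alpha>\<^sup>k / |\<xi>|\<^bsup>2k+2\<^esup>\<close> and \<open>\<beta>\<^sup>k / |\<xi>|\<^bsup>2k+2\<^esup>\<close> is, up to a constant, at least of the size \<open>|\<xi>|\<^bsup>-k-2\<^esup>\<close>.
  The coefficients are multiplied by a power of \<open>|\<xi>|\<^sup>2\<close> so that, once they are replaced by those of a
  function continuous at a point of the hyperplane, the right-hand side tends to 0 there.
\<close>

lemma singular_solution_lower_bound:
  assumes nz: "xi_norm2 q \<noteq> 0"
  shows "1 \<le> ((cmod (singular_solution k q k 0))\<^sup>2 + (cmod (singular_solution k q 0 k))\<^sup>2)
               * cmod (xi_norm2 q) ^ (k + 2) * 2 ^ k"
proof -
  define x where "x = (cmod (alpha q))\<^sup>2"
  define y where "y = (cmod (beta q))\<^sup>2"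
  define N where "N = cmod (xi_norm2 q)"
  have xy: "x \<ge> 0" "y \<ge> 0" by (simp_all add: x_def y_def)
  have "N = \<bar>x + y\<bar>" unfolding N_def xi_norm2_eq x_def y_def by (rule norm_of_real)
  moreover have "N > 0" using nz by (simp add: N_def)
  ultimately have N: "N = x + y" "N > 0" using xy by simp_all
  have pw: "(cmod z ^ k)\<^sup>2 = ((cmod z)\<^sup>2) ^ k" for z by (simp add: power_mult[symmetric] mult.commute)
  have "(cmod (singular_solution k q k 0))\<^sup>2 + (cmod (singular_solution k q 0 k))\<^sup>2
      = (x ^ k + y ^ k) * (inverse N ^ Suc k)\<^sup>2"
    by (simp add: singular_solution_def norm_mult norm_power norm_inverse power_mult_distrib pw
        x_def y_def N_def distrib_right del: power_Suc)
  also have "(inverse N ^ Suc k)\<^sup>2 * N ^ (k + 2) * N ^ k = 1"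
    using N(2) by (simp add: field_simps power2_eq_square)
  then have "(inverse N ^ Suc k)\<^sup>2 * N ^ (k + 2) = inverse (N ^ k)"
    using N(2) by (simp add: field_simps)
  then have "(x ^ k + y ^ k) * (inverse N ^ Suc k)\<^sup>2 * N ^ (k + 2) * 2 ^ k = (2 ^ k * (x ^ k + y ^ k)) / N ^ k"
    by (simp add: mult.assoc divide_inverse mult.commute mult.left_commute)
  moreover have "N ^ k \<le> 2 ^ k * (x ^ k + y ^ k)"
  proof -
    have "N ^ k \<le> (2 * max x y) ^ k" using N xy by (intro power_mono) auto
    also have "\<dots> \<le> 2 ^ k * (x ^ k + y ^ k)"
      using xy by (simp add: power_mult_distrib max_def)
    finally show ?thesis .
  qed
  ultimately show ?thesis using N(2) by (simp add: N_def[symmetric])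
qed

end

section \<open>Linearly convex domains\<close>

text \<open>
  If there were no such point, the component would be open and closed in \<open>D1\<close>, because the points
  of its closure that lie
  in \<open>D1 \<inter> D\<close> can be added to it without destroying connectedness.
\<close>

lemma component_boundary_point:
  fixes D D1 :: "'a::real_normed_vector set"
  assumes D1: "open D1" "connected D1" and D: "open D" and ns: "\<not> D1 \<subseteq> D" and x: "x \<in> D1 \<inter> D"
  obtains p where "p \<in> closure (connected_component_set (D1 \<inter> D) x)" "p \<in> D1" "p \<notin> D"
proof -
  define W where "W = connected_component_set (D1 \<inter> D) x"
  have W: "connected W" "W \<subseteq> D1 \<inter> D" "x \<in> W" "open W"
    using x D1(1) D connected_component_subset[of "D1 \<inter> D" x]
    by (auto simp: W_def open_connected_component open_Int)
  have "\<not> D1 \<inter> closure W \<subseteq> D"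
  proof
    assume sub: "D1 \<inter> closure W \<subseteq> D"
    have "connected (D1 \<inter> closure W)"
      using W closure_subset[of W] by (intro connected_intermediate_closure[OF W(1)]) auto
    then have "D1 \<inter> closure W \<subseteq> W"
      unfolding W_def using sub W(2,3) closure_subset[of W]
      by (intro connected_component_maximal) (auto simp: W_def)
    then have "W = D1 \<inter> closure W" using W(2) closure_subset[of W] by blast
    then have "closedin (top_of_set D1) W" unfolding closedin_closed using closed_closure by blast
    moreover have "openin (top_of_set D1) W" using W D1 by (intro open_openin_trans) auto
    ultimately have "W = D1" using D1(2) W(3) unfolding connected_clopen by blast
    then show False using W(2) ns by blast
  qed
  then show ?thesis using that unfolding W_def by blast
qed

theorem corollary4p2:
  fixes D :: "(quat ^ 'n::finite) set" and k :: nat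
  assumes "is_domain D" and "linearly_convex D"
  shows "domain_of_k_regularity k D"
  unfolding domain_of_k_regularity_def
proof (intro conjI notI)
  show "is_domain D" by fact
  have D: "open D" using assms(1) by (simp add: is_domain_def)
  assume "\<exists>D1 D2. open D1 \<and> open D2 \<and> D1 \<noteq> {} \<and> D2 \<noteq> {} \<and>
         connected D1 \<and> \<not> D1 \<subseteq> D \<and> D2 \<subseteq> D1 \<inter> D \<and>
         (\<forall>f\<in>k_regular_fns k D. \<exists>g\<in>k_regular_fns k D1. \<forall>q\<in>D2. f q = g q)"
  then obtain D1 D2 x where D1: "open D1" "connected D1" "\<not> D1 \<subseteq> D" and D2: "open D2" "x \<in> D2" "D2 \<subseteq> D1 \<inter> D"
    and ext: "\<And>f. f \<in> k_regular_fns k D \<Longrightarrow> \<exists>g\<in>k_regular_fns k D1. \<forall>q\<in>D2. f q = g q"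
    by blast
  define W where "W = connected_component_set (D1 \<inter> D) x"
  have xD: "x \<in> D1 \<inter> D" using D2 by blast
  have W: "connected W" "W \<subseteq> D1 \<inter> D" "x \<in> W" "open W"
    using xD D1(1) D connected_component_subset[of "D1 \<inter> D" x]
    by (auto simp: W_def open_connected_component open_Int)
  obtain p where p: "p \<in> closure W" "p \<in> D1" "p \<notin> D"
    using component_boundary_point[OF D1(1,2) D D1(3) xD] unfolding W_def .
  have "p \<in> frontier D"
    using p W(2) closure_mono[of W D] D by (auto simp: frontier_def interior_open)
  then obtain a b where hyp: "p \<in> quat_hyperplane a b" "quat_hyperplane a b \<inter> D = {}"
    using assms(2) unfolding linearly_convex_def by blast
  have nz: "xi_norm2 a b q \<noteq> 0" if "q \<in> D" for q using hyp(2) that xi_norm2_eq_0_iff[of a b q] by blast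
  define f where "f = singular_solution a b k"
  have f: "f \<in> k_regular_fns k S" if "open S" "S \<subseteq> D" for S
    unfolding f_def using that nz by (intro singular_solution_k_regular) auto
  obtain g where g: "g \<in> k_regular_fns k D1" "\<And>q. q \<in> D2 \<Longrightarrow> f q = g q"
    using ext[OF f[OF D subset_refl]] by blast
  have gW: "g \<in> k_regular_fns k W"
  proof -
    have "smooth_on (\<lambda>q. g q i j) W" for i j
      using g(1) W(2) by (intro smooth_on_subset[OF _ _ W(4), of _ D1]) (auto simp: k_regular_fns_def)
    then show ?thesis using g(1) W(2) by (auto simp: k_regular_fns_def)
  qed
  have eq: "f q = g q" if "q \<in> W" for q
    by (rule k_regular_identity[OF W(4,1) f gW _ _ _ _ that, of "W \<inter> D2"])
       (use W D2 g(2) in auto)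
  \<comment> \<open>finite on all of \<open>D1\<close>, at least 1 on \<open>W\<close> where \<open>g\<close> is the singular solution, but 0 at \<open>p\<close>\<close>
  define \<phi> where "\<phi> q = ((cmod (g q k 0))\<^sup>2 + (cmod (g q 0 k))\<^sup>2) * cmod (xi_norm2 a b q) ^ (k + 2) * 2 ^ k" for q
  have "\<phi> q \<ge> 1" if "q \<in> W" for q
    using singular_solution_lower_bound[OF nz, of q k] eq[OF that] that W(2)
    unfolding \<phi>_def f_def by auto
  moreover have "\<phi> p = 0"
    using hyp(1) xi_norm2_eq_0_iff[of a b p] by (simp add: \<phi>_def)
  moreover have "isCont \<phi> p"
  proof -
    have "isCont (\<lambda>q. g q i j) p" for i j
      using g(1) smooth_on_continuous[of "\<lambda>q. g q i j" D1] p(2) D1(1)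
      by (simp add: k_regular_fns_def continuous_on_eq_continuous_at)
    moreover have "isCont (xi_norm2 a b) p"
      using smooth_on_continuous[OF smooth_on_xi_norm2[OF open_UNIV, of a b]]
      by (simp add: continuous_on_eq_continuous_at)
    ultimately show ?thesis unfolding \<phi>_def by (intro continuous_intros)
  qed
  then obtain d where "d > 0" "\<And>q. dist q p < d \<Longrightarrow> \<bar>\<phi> q - \<phi> p\<bar> < 1"
    unfolding continuous_at_eps_delta dist_real_def using zero_less_one by blast
  moreover from \<open>d > 0\<close> obtain q where "q \<in> W" "dist q p < d"
    using p(1) closure_approachable by blast
  ultimately show False by fastforce
qed

end
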